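(* Fix $\sigma\in\{-1,0,1\}$, $\epsilon\in[0,1]$, reservoir parameters, and $\Upsilon>0$. For each $N$ let $\theta_i^{(N)}$ be the stationary microscopic profile of the boundary-driven switching system on $V=\{1,\dots,N\}$ with switching rate $\gamma=\gamma_N$, where $\gamma_NN^2\to\Upsilon$ as $N\to\infty$. Then for every $y\in(0,1)$ the limits $\rho_i^{stat}(y):=\lim_{N\to\infty}\theta_i^{(N)}(\lceil yN\rceil)$, $i\in\{0,1\}$, exist and are given as follows. If $\epsilon=0$: $\rho_0^{stat}(y)=\rho_1^{stat}(y)=\rho_{L,0}+(\rho_{R,0}-\rho_{L,0})y$. If $\epsilon>0$, with $B=B_{\epsilon,\Upsilon}=\sqrt{\Upsilon(1+1/\epsilon)}$ and $\Lambda(y)=\frac1{1+\epsilon}[\rho_{R,0}y+\rho_{L,0}(1-y)]+\frac\epsilon{1+\epsilon}[\rho_{R,1}y+\rho_{L,1}(1-y)]$, $$\rho_0^{stat}(y)=\tfrac{\epsilon}{1+\epsilon}\Big[\tfrac{\sinh(B(1-y))}{\sinh B}(\rho_{L,0}-\rho_{L,1})+\tfrac{\sinh(By)}{\sinh B}(\rho_{R,0}-\rho_{R,1})\Big]+\Lambda(y),$$ $$\rho_1^{stat}(y)=\tfrac{1}{1+\epsilon}\Big[\tfrac{\sinh(B(1-y))}{\sinh B}(\rho_{L,1}-\rho_{L,0})+\tfrac{\sinh(By)}{\sinh B}(\rho_{R,1}-\rho_{R,0})\Big]+\Lambda(y).$$ Moreover, when $\epsilon>0$ both limits hold uniformly in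 $y\in(0,1)$.
   Context: Boundary-driven switching system: fix $\sigma\in\{-1,0,1\}$, $N\in\mathbb N$, $V=\{1,\dots,N\}$, $\epsilon\in[0,1]$, $\gamma>0$, and reservoir parameters $\rho_{L,0},\rho_{L,1},\rho_{R,0},\rho_{R,1}\ge0$ (in $[0,1]$ if $\sigma=-1$). Configurations are $\eta=(\eta_0(x),\eta_1(x))_{x\in V}$ with values in $\{0,1\}$ if $\sigma=-1$ and in $\mathbb N_0$ if $\sigma\in\{0,1\}$. Writing $\delta_{(x,i)}$ for one particle at site $x$ in layer $i$, the continuous-time Markov chain has transitions: for $x\in\{1,\dots,N-1\}$, $i\in\{0,1\}$, $\eta\to\eta-\delta_{(x,i)}+\delta_{(x+1,i)}$ at rate $\epsilon^i\eta_i(x)(1+\sigma\eta_i(x+1))$ and $\eta\to\eta-\delta_{(x+1,i)}+\delta_{(x,i)}$ at rate $\epsilon^i\eta_i(x+1)(1+\sigma\eta_i(x))$ ($\epsilon^0=1$); for $x\in V$, $\eta\to\eta-\delta_{(x,i)}+\delta_{(x,1-i)}$ at rate $\gamma\eta_i(x)(1+\sigma\eta_{1-i}(x))$; and for $i\in\{0,1\}$, $\eta\to\eta-\delta_{(1,i)}$ at rate $\eta_i(1)(1+\sigma\rho_{L,i})$, $\eta\to\eta+\delta_{(1,i)}$ at rate $\rho_{L,i}(1+\sigma\eta_i(1))$, $\eta\to\eta-\delta_{(N,i)}$ at rate $\eta_i(N)(1+\sigma\rho_{R,i})$, $\eta\to\eta+\delta_{(N,i)}$ at rate $\rho_{R,i}(1+\sigma\eta_i(N))$.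 This chain has a unique stationary distribution $\mu_{stat}$, and $\theta_i(x):=\mathbb E_{\mu_{stat}}[\eta_i(x)]$ is the stationary microscopic profile. *)

theory Defs
  imports "HOL-Probability.Probability"
begin

text \<open>A configuration assigns to each pair (x, i) (site x, layer i) a particle number.
  Only sites x in {1..N} and layers i in {0,1} are meaningful; elsewhere the value is 0.\<close>
type_synonym config = "nat \<times> nat \<Rightarrow> nat"

definition valid_config :: "int \<Rightarrow> nat \<Rightarrow> config \<Rightarrow> bool" where
  "valid_config \<sigma> N \<eta> \<longleftrightarrow>
     (\<forall>x i. (x < 1 \<or> x > N \<or> i > 1) \<longrightarrow> \<eta> (x, i) = 0) \<and>
     (\<sigma> = -1 \<longrightarrow> (\<forall>x i. \<eta> (x, i) \<le> 1))"

definition add_p :: "config \<Rightarrow> nat \<times> nat \<Rightarrow> config" where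
  "add_p \<eta> a = \<eta>(a := \<eta> a + 1)"

definition rem_p :: "config \<Rightarrow> nat \<times> nat \<Rightarrow> config" where
  "rem_p \<eta> a = \<eta>(a := \<eta> a - 1)"

definition transitions ::
  "int \<Rightarrow> nat \<Rightarrow> real \<Rightarrow> real \<Rightarrow> (nat \<Rightarrow> real) \<Rightarrow> (nat \<Rightarrow> real) \<Rightarrow> config \<Rightarrow> (real \<times> config) list" where
  "transitions \<sigma> N \<epsilon> \<gamma> \<rho>L \<rho>R \<eta> =
     concat (map (\<lambda>x. concat (map (\<lambda>i.
        [ (\<epsilon> ^ i * real (\<eta> (x, i)) * (1 + of_int \<sigma> * real (\<eta> (x + 1, i))),
             add_p (rem_p \<eta> (x, i)) (x + 1, i)),
          (\<epsilon> ^ i * real (\<eta> (x + 1, i)) * (1 + of_int \<sigma> * real (\<eta> (x, i))),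
             add_p (rem_p \<eta> (x + 1, i)) (x, i)) ]) [0::nat, 1])) [1..<N])
   @ concat (map (\<lambda>x. concat (map (\<lambda>i.
        [ (\<gamma> * real (\<eta> (x, i)) * (1 + of_int \<sigma> * real (\<eta> (x, 1 - i))),
             add_p (rem_p \<eta> (x, i)) (x, 1 - i)) ]) [0::nat, 1])) [1..<N + 1])
   @ concat (map (\<lambda>i.
        [ (real (\<eta> (1, i)) * (1 + of_int \<sigma> * \<rho>L i), rem_p \<eta> (1, i)),
          (\<rho>L i * (1 + of_int \<sigma> * real (\<eta> (1, i))), add_p \<eta> (1, i)),
          (real (\<eta> (N, i)) * (1 + of_int \<sigma> * \<rho>R i), rem_p \<eta> (N, i)),
          (\<rho>R i * (1 + of_int \<sigma> * real (\<eta> (N, i))), add_p \<eta> (N, i)) ]) [0::nat, 1])"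

definition jump_rate ::
  "int \<Rightarrow> nat \<Rightarrow> real \<Rightarrow> real \<Rightarrow> (nat \<Rightarrow> real) \<Rightarrow> (nat \<Rightarrow> real) \<Rightarrow> config \<Rightarrow> config \<Rightarrow> real" where
  "jump_rate \<sigma> N \<epsilon> \<gamma> \<rho>L \<rho>R \<eta> \<eta>' =
     sum_list (map fst (filter (\<lambda>p. snd p = \<eta>') (transitions \<sigma> N \<epsilon> \<gamma> \<rho>L \<rho>R \<eta>)))"

definition exit_rate ::
  "int \<Rightarrow> nat \<Rightarrow> real \<Rightarrow> real \<Rightarrow> (nat \<Rightarrow> real) \<Rightarrow> (nat \<Rightarrow> real) \<Rightarrow> config \<Rightarrow> real" where
  "exit_rate \<sigma> N \<epsilon> \<gamma> \<rho>L \<rho>R \<eta> = sum_list (map fst (transitions \<sigma> N \<epsilon> \<gamma> \<rho>L \<rho>R \<eta>))"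

definition stationary ::
  "int \<Rightarrow> nat \<Rightarrow> real \<Rightarrow> real \<Rightarrow> (nat \<Rightarrow> real) \<Rightarrow> (nat \<Rightarrow> real) \<Rightarrow> config pmf \<Rightarrow> bool" where
  "stationary \<sigma> N \<epsilon> \<gamma> \<rho>L \<rho>R \<mu> \<longleftrightarrow>
     set_pmf \<mu> \<subseteq> {\<eta>. valid_config \<sigma> N \<eta>} \<and>
     (\<forall>\<eta>'. (\<Sum>\<^sub>\<infinity>\<eta>. pmf \<mu> \<eta> * jump_rate \<sigma> N \<epsilon> \<gamma> \<rho>L \<rho>R \<eta> \<eta>')
            = pmf \<mu> \<eta>' * exit_rate \<sigma> N \<epsilon> \<gamma> \<rho>L \<rho>R \<eta>')"

definition profile :: "config pmf \<Rightarrow> nat \<Rightarrow> nat \<Rightarrow> real" where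
  "profile \<mu> i x = measure_pmf.expectation \<mu> (\<lambda>\<eta>. real (\<eta> (x, i)))"

definition rho_stat :: "real \<Rightarrow> real \<Rightarrow> (nat \<Rightarrow> real) \<Rightarrow> (nat \<Rightarrow> real) \<Rightarrow> nat \<Rightarrow> real \<Rightarrow> real" where
  "rho_stat \<epsilon> \<Upsilon> \<rho>L \<rho>R i y =
     (if \<epsilon> = 0 then \<rho>L 0 + (\<rho>R 0 - \<rho>L 0) * y
      else
        (let B = sqrt (\<Upsilon> * (1 + 1 / \<epsilon>));
             \<Lambda> = 1 / (1 + \<epsilon>) * (\<rho>R 0 * y + \<rho>L 0 * (1 - y))
                 + \<epsilon> / (1 + \<epsilon>) * (\<rho>R 1 * y + \<rho>L 1 * (1 - y))
         in if i = 0 then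
              \<epsilon> / (1 + \<epsilon>) * (sinh (B * (1 - y)) / sinh B * (\<rho>L 0 - \<rho>L 1)
                               + sinh (B * y) / sinh B * (\<rho>R 0 - \<rho>R 1)) + \<Lambda>
            else
              1 / (1 + \<epsilon>) * (sinh (B * (1 - y)) / sinh B * (\<rho>L 1 - \<rho>L 0)
                               + sinh (B * y) / sinh B * (\<rho>R 1 - \<rho>R 0)) + \<Lambda>))"

end

(* A stationary measure is only known through global balance, and for sigma >= 0 the state space is
   infinite. Balance can be tested against functions vanishing above a level K of the total particle
   number, and the truncation error of a function linear in the occupation numbers is at most K times
   the flux of particles killed at level K + 1. These fluxes are summable, so the error tends to 0
   along a subsequence. A barrier function with drift at most a constant minus the particle number
   then makes the particle number integrable, and every linear test function has mean drift 0. This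
   gives the closed linear system for the stationary profile; the sigma terms cancel in pairs.

   The discrete system satisfies a minimum principle. With the same barrier, a bulk residual o(1/N^2)
   and a residual o(1) at the two end sites force an error o(1), so it suffices to insert the limit
   profile, sampled at x / (N + 1), into the discrete system. *)

theory Submission
  imports Defs "HOL-Real_Asymp.Real_Asymp"
begin

text \<open>Balance alone gives no moment bound, so the truncation errors cannot be dismissed by
  integrability, which is itself to be proved. The way out is that particles enter and leave only at
  the end sites. A test function that vanishes just above the cut leaves one error term of known
  sign, and this bounds the mean occupation of the end sites by the reservoir parameters. The rates
  of loss at all levels together are at most a constant times that occupation, hence summable; as
  the harmonic series diverges, some high levels have small flux even after multiplication by the
  level. The second obstacle is that the reservoirs act at rate 1 on both layers, while layer 1 hops
  at rate \<epsilon>. The sampled limit profile therefore misses the equations at the end sites by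
  much more than 1/N^2. Killing at rate 1 at the ends repairs this: a small constant compensates any
  small defect there. For \<epsilon> = 0 layer 1 does not diffuse at all, and only switching can
  transport information; its cost 1/\<gamma> is of order N^2, the same as that of diffusion across
  the system.\<close>

section \<open>Discrete operators, minimum principle and barrier\<close>

definition discrete_laplacian :: "nat \<Rightarrow> (nat \<Rightarrow> real) \<Rightarrow> nat \<Rightarrow> real" where
  "discrete_laplacian N u x =
     (if x < N then u (x + 1) - u x else 0) + (if 1 < x then u (x - 1) - u x else 0)"

lemma discrete_laplacian_const [simp]: "discrete_laplacian N (\<lambda>_. c) x = 0"
  by (simp add: discrete_laplacian_def)

text \<open>The Laplacian is reflecting at both ends, so no boundary terms appear. The left side is
  symmetric in \<open>h\<close> and \<open>u\<close>, which is how the lemma is used.\<close>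

lemma summation_by_parts:
  assumes "1 \<le> N"
  shows "(\<Sum>x=1..<N. (h (x + 1) - h x) * (u x - u (x + 1))) =
         (\<Sum>x=1..N. u x * discrete_laplacian N h x)"
  using assms
proof (induction N rule: nat_induct_at_least)
  case base
  show ?case by (simp add: discrete_laplacian_def)
next
  case (Suc n)
  have "(\<Sum>x=1..Suc n. u x * discrete_laplacian (Suc n) h x)
     = (\<Sum>x=1..n. u x * discrete_laplacian n h x + (if x = n then u n * (h (n + 1) - h n) else 0))
       + u (Suc n) * (h n - h (Suc n))"
    using Suc.hyps by (auto intro!: sum.cong simp: discrete_laplacian_def algebra_simps)
  also have "\<dots> = (\<Sum>x=1..n. u x * discrete_laplacian n h x) + u n * (h (n + 1) - h n)
       + u (Suc n) * (h n - h (Suc n))"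
    using Suc.hyps by (simp add: sum.distrib)
  finally show ?case
    using Suc by (simp add: algebra_simps)
qed

text \<open>Generator of a single walker that hops at speed \<epsilon>^i, switches layers at rate
  \<gamma> and is killed at rate 1 at either end. The killing is what the reservoirs leave behind:
  birth minus death at an end site is \<rho>(1 + \<sigma>\<eta>) - \<eta>(1 + \<sigma>\<rho>) =
  \<rho> - \<eta>. The natural number \<open>1 - i\<close> is the other layer.\<close>

definition site_generator ::
  "nat \<Rightarrow> real \<Rightarrow> real \<Rightarrow> (nat \<Rightarrow> nat \<Rightarrow> real) \<Rightarrow> nat \<Rightarrow> nat \<Rightarrow> real" where
  "site_generator N \<epsilon> \<gamma> h i x =
     \<epsilon> ^ i * discrete_laplacian N (h i) x + \<gamma> * (h (1 - i) x - h i x)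
     - (if x = 1 then h i x else 0) - (if x = N then h i x else 0)"

text \<open>Hopping, switching and killing are symmetric separately. Symmetry later moves the
  operator from a test function to the profile.\<close>

lemma site_generator_symmetric:
  assumes "1 \<le> N"
  shows "(\<Sum>x=1..N. \<Sum>i\<in>{0,1}. u i x * site_generator N \<epsilon> \<gamma> h i x) =
         (\<Sum>x=1..N. \<Sum>i\<in>{0,1}. h i x * site_generator N \<epsilon> \<gamma> u i x)"
proof -
  have sym: "(\<Sum>x=1..N. u i x * discrete_laplacian N (h i) x) =
      (\<Sum>x=1..N. h i x * discrete_laplacian N (u i) x)" for i
    unfolding summation_by_parts[OF assms, symmetric] by (simp add: algebra_simps)
  have split: "(\<Sum>x=1..N. \<Sum>i\<in>{0,1}. u i x * site_generator N \<epsilon> \<gamma> h i x) =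
      (\<Sum>x=1..N. u 0 x * discrete_laplacian N (h 0) x)
      + \<epsilon> * (\<Sum>x=1..N. u 1 x * discrete_laplacian N (h 1) x)
      - (\<Sum>x=1..N. \<gamma> * ((u 1 x - u 0 x) * (h 1 x - h 0 x))
          + (if x = 1 then u 0 x * h 0 x + u 1 x * h 1 x else 0)
          + (if x = N then u 0 x * h 0 x + u 1 x * h 1 x else 0))" for u h
    unfolding sum_distrib_left sum.distrib[symmetric] sum_subtractf[symmetric]
    by (intro sum.cong) (auto simp: site_generator_def algebra_simps)
  show ?thesis
    unfolding split sym by (intro arg_cong2[where f="(-)"] sum.cong) (auto simp: algebra_simps)
qed

text \<open>At a negative minimum the Laplacian, the switching term and the killing term are all
  nonnegative. Asking for strict negativity avoids propagating the minimum from site to site, which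
  hopping cannot do in layer 1 when \<epsilon> = 0.\<close>

lemma site_generator_minimum_principle:
  assumes N: "1 \<le> N" and eps: "0 \<le> \<epsilon>" and gam: "0 \<le> \<gamma>"
    and neg: "\<And>i x. i \<in> {0,1} \<Longrightarrow> x \<in> {1..N} \<Longrightarrow> site_generator N \<epsilon> \<gamma> F i x < 0"
    and i: "i \<in> {0,1}" and x: "x \<in> {1..N}"
  shows "0 \<le> F i x"
proof -
  have "finite ({0,1::nat} \<times> {1..N})" "{0,1::nat} \<times> {1..N} \<noteq> {}"
    using N by auto
  from ex_min_if_finite[OF finite_imageI[OF this(1), of "\<lambda>(i,x). F i x"]] this(2)
  obtain m where m: "m \<in> (\<lambda>(i,x). F i x) ` ({0,1} \<times> {1..N})"
    and mn: "\<not> (\<exists>y \<in> (\<lambda>(i,x). F i x) ` ({0,1} \<times> {1..N}). y < m)"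
    by blast
  from m obtain p where "p \<in> {0,1} \<times> {1..N}" "m = (case p of (i, x) \<Rightarrow> F i x)" by blast
  then obtain j y where jy: "j \<in> {0,1}" "y \<in> {1..N}" "m = F j y"
    by (metis case_prod_conv mem_Sigma_iff surj_pair)
  have le: "F j y \<le> F k z" if "k \<in> {0,1}" "z \<in> {1..N}" for k z
    using mn that jy(3) by (auto simp: not_less)
  have "0 \<le> F j y"
  proof (rule ccontr)
    assume neg0: "\<not> 0 \<le> F j y"
    have "F j y \<le> F j (y + 1)" if "y < N"
      using that jy by (intro le) auto
    moreover have "F j y \<le> F j (y - 1)" if "1 < y"
      using that jy by (intro le) auto
    ultimately have "0 \<le> discrete_laplacian N (F j) y"
      unfolding discrete_laplacian_def by (intro add_nonneg_nonneg) auto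
    moreover have "F j y \<le> F (1 - j) y"
      using le[of "1 - j" y] jy by auto
    ultimately have "0 \<le> \<epsilon> ^ j * discrete_laplacian N (F j) y"
      and "0 \<le> \<gamma> * (F (1 - j) y - F j y)" using eps gam by auto
    then have "0 \<le> site_generator N \<epsilon> \<gamma> F j y"
      unfolding site_generator_def using neg0 by (auto split: if_splits)
    with neg[OF jy(1,2)] show False by simp
  qed
  with le[OF i x] show ?thesis by simp
qed

text \<open>The quadratic is the classical exit time profile for the interval from 0 to N + 1. The
  extra 1/\<gamma> is the mean waiting time for a switch out of layer 1; it gives that layer
  negative drift without any diffusion.\<close>

definition barrier :: "nat \<Rightarrow> real \<Rightarrow> nat \<Rightarrow> nat \<Rightarrow> real" where
  "barrier N \<gamma> i x = real x * (real N + 1 - real x) + real i / \<gamma>"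

lemma barrier_nonneg: "0 < \<gamma> \<Longrightarrow> x \<le> N \<Longrightarrow> 0 \<le> barrier N \<gamma> i x"
  unfolding barrier_def by (intro add_nonneg_nonneg mult_nonneg_nonneg divide_nonneg_nonneg) auto

text \<open>In layer 0 reflection plus killing amounts to a zero condition at 0 and N + 1, so the
  quadratic contributes -2 at every site and the switch into layer 1 costs +1. In layer 1 switching
  alone yields -1; the remaining terms are at most 0, at the ends because killing removes N while
  hopping adds at most N - 2.\<close>

lemma site_generator_barrier:
  assumes N: "2 \<le> N" and eps: "0 \<le> \<epsilon>" "\<epsilon> \<le> 1" and gam: "0 < \<gamma>"
    and i: "i \<in> {0,1}" and x: "x \<in> {1..N}"
  shows "site_generator N \<epsilon> \<gamma> (barrier N \<gamma>) i x \<le> -1"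
proof -
  have lap: "discrete_laplacian N (barrier N \<gamma> i) x =
      (if x = 1 \<or> x = N then real N - 2 else -2)"
  proof -
    consider "x = 1" | "x = N" | "1 < x" "x < N" using x by fastforce
    then show ?thesis
      using N by cases
        (auto simp: discrete_laplacian_def barrier_def of_nat_diff algebra_simps)
  qed
  have e1: "\<epsilon> * (real N - 2) \<le> real N - 2"
    using N eps by (intro mult_left_le_one_le) auto
  have "0 \<le> 1 / \<gamma>" using gam by simp
  with e1 have e2: "\<epsilon> * (real N - 2) \<le> real N + 1 / \<gamma>" by linarith
  consider "x = 1" | "x = N" | "1 < x" "x < N" using x by fastforce
  then show ?thesis
    unfolding site_generator_def lap
    using i N gam eps(1) e1 e2 by cases (auto simp: barrier_def)
qed

lemma site_generator_comparison:
  assumes N: "2 \<le> N" and eps: "0 \<le> \<epsilon>" "\<epsilon> \<le> 1" and gam: "0 < \<gamma>" and del: "0 < \<delta>"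
    and small: "\<And>i x. i \<in> {0,1} \<Longrightarrow> x \<in> {1..N} \<Longrightarrow>
        \<bar>site_generator N \<epsilon> \<gamma> e i x\<bar> < \<delta> * ((if x = 1 \<or> x = N then 1 else 0) + 1 / (real N)\<^sup>2)"
    and i: "i \<in> {0,1}" and x: "x \<in> {1..N}"
  shows "\<bar>e i x\<bar> \<le> \<delta> * (2 + 1 / (\<gamma> * (real N)\<^sup>2))"
proof -
  \<comment> \<open>Two comparison functions for two scales: the constant 1 feels only the killing
    and gives -1 at the ends, the barrier divided by N^2 gives at most -1/N^2 everywhere.\<close>
  define S where "S i x = \<delta> * (1 + barrier N \<gamma> i x / (real N)\<^sup>2)" for i x
  have AS: "site_generator N \<epsilon> \<gamma> (\<lambda>i x. S i x + s * e i x) j y < 0"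
    if s: "s = 1 \<or> s = -1" and j: "j \<in> {0,1}" and y: "y \<in> {1..N}" for s j y
  proof -
    have "site_generator N \<epsilon> \<gamma> (\<lambda>i x. S i x + s * e i x) j y =
       - \<delta> * (if y = 1 \<or> y = N then 1 else 0)
       + \<delta> / (real N)\<^sup>2 * site_generator N \<epsilon> \<gamma> (barrier N \<gamma>) j y + s * site_generator N \<epsilon> \<gamma> e j y"
      unfolding site_generator_def discrete_laplacian_def S_def using N
      by (auto simp: algebra_simps add_divide_distrib diff_divide_distrib)
    moreover have "\<delta> / (real N)\<^sup>2 * site_generator N \<epsilon> \<gamma> (barrier N \<gamma>) j y \<le> \<delta> / (real N)\<^sup>2 * (-1)"
      using del by (intro mult_left_mono site_generator_barrier N eps gam j y) auto
    moreover have "s * site_generator N \<epsilon> \<gamma> e j y \<le> \<bar>site_generator N \<epsilon> \<gamma> e j y\<bar>"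
      using s by auto
    ultimately show ?thesis using small[OF j y] by (simp add: algebra_simps split: if_splits)
  qed
  have "0 \<le> S i x + s * e i x" if s: "s = 1 \<or> s = -1" for s
    using site_generator_minimum_principle[of N \<epsilon> \<gamma> "\<lambda>i x. S i x + s * e i x" i x] AS[OF s] i x N eps gam
    by auto
  from this[of 1] this[of "-1"] have "\<bar>e i x\<bar> \<le> S i x" by auto
  also have "\<dots> \<le> \<delta> * (2 + 1 / (\<gamma> * (real N)\<^sup>2))"
  proof -
    have "real x * (real N + 1 - real x) \<le> real N * real N"
      using x by (intro mult_mono) auto
    moreover have "real i / \<gamma> \<le> 1 / \<gamma>" using i gam by auto
    ultimately have "barrier N \<gamma> i x \<le> (real N)\<^sup>2 + 1 / \<gamma>"
      unfolding barrier_def by (simp add: power2_eq_square)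
    then have "barrier N \<gamma> i x / (real N)\<^sup>2 \<le> ((real N)\<^sup>2 + 1 / \<gamma>) / (real N)\<^sup>2"
      by (intro divide_right_mono) auto
    also have "\<dots> = 1 + 1 / (\<gamma> * (real N)\<^sup>2)" using N gam by (simp add: field_simps)
    finally show ?thesis unfolding S_def using del by (intro mult_left_mono) auto
  qed
  finally show ?thesis .
qed

section \<open>Global balance tested against truncated functions\<close>

text \<open>Several entries of the transition list may share a target; grouping them by target
  converts between \<open>jump_rate\<close> and a sum over individual jumps.\<close>

lemma sum_list_filter_snd:
  fixes xs :: "(real \<times> 'a) list"
  assumes "finite F" and "\<And>z. z \<notin> F \<Longrightarrow> f z = 0"
  shows "(\<Sum>z\<in>F. f z * sum_list (map fst (filter (\<lambda>p. snd p = z) xs))) =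
         (\<Sum>p\<leftarrow>xs. fst p * f (snd p))"
proof (induction xs)
  case (Cons p xs)
  have "(\<Sum>z\<in>F. f z * sum_list (map fst (filter (\<lambda>q. snd q = z) (p # xs)))) =
     (\<Sum>z\<in>F. (if snd p = z then f z * fst p else 0)
        + f z * sum_list (map fst (filter (\<lambda>q. snd q = z) xs)))"
    by (intro sum.cong) (auto simp: algebra_simps)
  also have "\<dots> = fst p * f (snd p) + (\<Sum>q\<leftarrow>xs. fst q * f (snd q))"
    using assms Cons by (auto simp: sum.distrib sum.delta')
  finally show ?case by simp
qed simp

text \<open>For N = 1 the two end sites coincide. The limit sees only large N, so
  \<open>2 \<le> N\<close> is built in and the ends stay distinct.\<close>

locale boundary_driven =
  fixes \<sigma> :: int and N :: nat and \<epsilon> \<gamma> :: real and \<rho>L \<rho>R :: "nat \<Rightarrow> real" and \<mu> :: "config pmf"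
  assumes sigma: "\<sigma> \<in> {-1, 0, 1}"
    and N2: "2 \<le> N"
    and eps: "0 \<le> \<epsilon>" "\<epsilon> \<le> 1"
    and gamma: "0 < \<gamma>"
    and rho_nonneg: "\<And>i. i \<in> {0,1} \<Longrightarrow> 0 \<le> \<rho>L i \<and> 0 \<le> \<rho>R i"
    and rho_excl: "\<And>i. \<sigma> = -1 \<Longrightarrow> i \<in> {0,1} \<Longrightarrow> \<rho>L i \<le> 1 \<and> \<rho>R i \<le> 1"
    and stationary: "stationary \<sigma> N \<epsilon> \<gamma> \<rho>L \<rho>R \<mu>"
begin

lemma rhoL_nonneg: "i \<in> {0,1} \<Longrightarrow> 0 \<le> \<rho>L i"
  and rhoR_nonneg: "i \<in> {0,1} \<Longrightarrow> 0 \<le> \<rho>R i"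
  using rho_nonneg by simp_all

abbreviation "jumps \<equiv> transitions \<sigma> N \<epsilon> \<gamma> \<rho>L \<rho>R"
abbreviation "valid \<equiv> valid_config \<sigma> N"

definition total :: "config \<Rightarrow> nat" where
  "total \<eta> = (\<Sum>x=1..N. \<Sum>i\<in>{0,1}. \<eta> (x, i))"

definition configs :: "nat \<Rightarrow> config set" where
  "configs K = {\<eta>. valid \<eta> \<and> total \<eta> \<le> K}"

text \<open>The constant \<open>c\<close> has no influence on the drift, but once the function is
  cut off it changes the error terms; this freedom is exploited below.\<close>

definition lin :: "real \<Rightarrow> (nat \<Rightarrow> nat \<Rightarrow> real) \<Rightarrow> config \<Rightarrow> real" where
  "lin c h \<eta> = c + (\<Sum>x=1..N. \<Sum>i\<in>{0,1}. h i x * real (\<eta> (x, i)))"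

text \<open>Kept general in \<open>g\<close> because it serves both for generator terms and for the
  rate into one fixed target.\<close>

lemma sum_transitions:
  fixes g :: "real \<times> config \<Rightarrow> real"
  shows "(\<Sum>p\<leftarrow>jumps \<eta>. g p) =
     (\<Sum>x=1..<N. \<Sum>i\<in>{0,1}.
        g (\<epsilon> ^ i * real (\<eta> (x, i)) * (1 + of_int \<sigma> * real (\<eta> (x + 1, i))),
           add_p (rem_p \<eta> (x, i)) (x + 1, i))
      + g (\<epsilon> ^ i * real (\<eta> (x + 1, i)) * (1 + of_int \<sigma> * real (\<eta> (x, i))),
           add_p (rem_p \<eta> (x + 1, i)) (x, i)))
   + (\<Sum>x=1..N. \<Sum>i\<in>{0,1}.
        g (\<gamma> * real (\<eta> (x, i)) * (1 + of_int \<sigma> * real (\<eta> (x, 1 - i))),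
           add_p (rem_p \<eta> (x, i)) (x, 1 - i)))
   + (\<Sum>i\<in>{0,1}.
        g (\<rho>L i * (1 + of_int \<sigma> * real (\<eta> (1, i))), add_p \<eta> (1, i))
      + g (\<rho>R i * (1 + of_int \<sigma> * real (\<eta> (N, i))), add_p \<eta> (N, i)))
   + (\<Sum>i\<in>{0,1}.
        g (real (\<eta> (1, i)) * (1 + of_int \<sigma> * \<rho>L i), rem_p \<eta> (1, i))
      + g (real (\<eta> (N, i)) * (1 + of_int \<sigma> * \<rho>R i), rem_p \<eta> (N, i)))"
proof -
  have *: "(\<Sum>p\<leftarrow>concat (map F xs). g p) = (\<Sum>x\<leftarrow>xs. \<Sum>p\<leftarrow>F x. g p)"
    for F :: "nat \<Rightarrow> (real \<times> config) list" and xs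
    by (induction xs) auto
  show ?thesis
    unfolding transitions_def map_append sum_list_append * interv_sum_list_conv_sum_set_nat
      set_upt
    by (simp add: atLeastLessThanSuc_atLeastAtMost add_ac)
qed

lemma finite_configs: "finite (configs K)"
proof (rule finite_subset)
  let ?A = "{1..N} \<times> {0,1::nat}"
  show "finite {\<eta>. \<forall>a. (a \<in> ?A \<longrightarrow> \<eta> a \<in> {..K}) \<and> (a \<notin> ?A \<longrightarrow> \<eta> a = 0)}"
    by (rule finite_set_of_finite_funs) auto
  show "configs K \<subseteq> {\<eta>. \<forall>a. (a \<in> ?A \<longrightarrow> \<eta> a \<in> {..K}) \<and> (a \<notin> ?A \<longrightarrow> \<eta> a = 0)}"
  proof (clarify, intro conjI impI)
    fix \<eta> x i assume e: "\<eta> \<in> configs K"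
    { assume "(x, i) \<in> ?A"
      then have x: "x \<in> {1..N}" and i: "i \<in> {0,1}" by auto
      have "\<eta> (x, i) \<le> (\<Sum>i\<in>{0,1}. \<eta> (x, i))"
        by (rule member_le_sum[OF i, of "\<lambda>i. \<eta> (x, i)"]) auto
      also have "\<dots> \<le> total \<eta>"
        unfolding total_def
        by (rule member_le_sum[OF x, of "\<lambda>x. \<Sum>i\<in>{0,1}. \<eta> (x, i)"]) auto
      finally show "\<eta> (x, i) \<in> {..K}" using e by (simp add: configs_def) }
    assume "(x, i) \<notin> ?A"
    then have "x < 1 \<or> x > N \<or> i > 1" by auto
    with e show "\<eta> (x, i) = 0" by (auto simp: configs_def valid_config_def)
  qed
qed

lemma lin_add_p:
  assumes "x \<in> {1..N}" "i \<in> {0,1}"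
  shows "lin c h (add_p \<eta> (x, i)) = lin c h \<eta> + h i x"
proof -
  have "(\<Sum>y=1..N. \<Sum>j\<in>{0,1}. h j y * real (add_p \<eta> (x, i) (y, j))) =
     (\<Sum>y=1..N. (\<Sum>j\<in>{0,1}. h j y * real (\<eta> (y, j))) + (if y = x then h i x else 0))"
    using assms(2) by (intro sum.cong) (auto simp: add_p_def algebra_simps)
  then show ?thesis using assms(1) by (simp add: lin_def sum.distrib)
qed

lemma lin_rem_p:
  assumes "x \<in> {1..N}" "i \<in> {0,1}" "\<eta> (x, i) \<noteq> 0"
  shows "lin c h (rem_p \<eta> (x, i)) = lin c h \<eta> - h i x"
proof -
  have "add_p (rem_p \<eta> (x, i)) (x, i) = \<eta>"
    using assms(3) by (auto simp: add_p_def rem_p_def fun_eq_iff)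
  with lin_add_p[OF assms(1,2), of c h "rem_p \<eta> (x, i)"] show ?thesis by simp
qed

lemma real_total: "real (total \<eta>) = lin 0 (\<lambda>_ _. 1) \<eta>"
  by (simp add: total_def lin_def)

lemma total_add_p:
  "x \<in> {1..N} \<Longrightarrow> i \<in> {0,1} \<Longrightarrow> total (add_p \<eta> (x, i)) = total \<eta> + 1"
  using lin_add_p[of x i 0 "\<lambda>_ _. 1" \<eta>] unfolding real_total[symmetric] by linarith

lemma total_rem_p:
  "x \<in> {1..N} \<Longrightarrow> i \<in> {0,1} \<Longrightarrow> \<eta> (x, i) \<noteq> 0 \<Longrightarrow> total \<eta> = total (rem_p \<eta> (x, i)) + 1"
  using lin_rem_p[of x i \<eta> 0 "\<lambda>_ _. 1"] unfolding real_total[symmetric] by linarith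

lemma valid_rem_p: "valid \<eta> \<Longrightarrow> valid (rem_p \<eta> a)"
proof -
  assume "valid \<eta>"
  moreover have "rem_p \<eta> a b \<le> \<eta> b" for b by (simp add: rem_p_def)
  ultimately show "valid (rem_p \<eta> a)"
    unfolding valid_config_def by (metis le_zero_eq order_trans)
qed

lemma valid_add_p:
  "valid \<eta> \<Longrightarrow> x \<in> {1..N} \<Longrightarrow> i \<in> {0,1} \<Longrightarrow> \<sigma> = -1 \<longrightarrow> \<eta> (x, i) = 0 \<Longrightarrow> valid (add_p \<eta> (x, i))"
  unfolding valid_config_def add_p_def by auto

lemma exclusion_empty:
  assumes "valid \<eta>" "1 + of_int \<sigma> * real (\<eta> a) \<noteq> 0"
  shows "\<sigma> = -1 \<longrightarrow> \<eta> a = 0"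
proof
  assume s: "\<sigma> = -1"
  then have "\<eta> a \<le> 1" using assms(1) by (cases a) (auto simp: valid_config_def)
  moreover have "\<eta> a \<noteq> 1" using assms(2) s by auto
  ultimately show "\<eta> a = 0" by linarith
qed

lemma exclusion_nonneg:
  assumes "valid \<eta>"
  shows "0 \<le> 1 + of_int \<sigma> * real (\<eta> a)"
proof (cases "\<sigma> = -1")
  case True
  then have "\<eta> a \<le> 1" using assms by (cases a) (auto simp: valid_config_def)
  with True show ?thesis by simp
next
  case False
  with sigma show ?thesis by auto
qed

lemma reservoir_nonneg:
  assumes "i \<in> {0,1}"
  shows "0 \<le> 1 + of_int \<sigma> * \<rho>L i" "0 \<le> 1 + of_int \<sigma> * \<rho>R i"
proof -
  consider "\<sigma> = -1" | "\<sigma> = 0" | "\<sigma> = 1" using sigma by auto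
  then show "0 \<le> 1 + of_int \<sigma> * \<rho>L i" "0 \<le> 1 + of_int \<sigma> * \<rho>R i"
    using rho_nonneg[OF assms] rho_excl[OF _ assms] by (cases; simp)+
qed

definition trunc :: "nat \<Rightarrow> real \<Rightarrow> (nat \<Rightarrow> nat \<Rightarrow> real) \<Rightarrow> config \<Rightarrow> real" where
  "trunc K c h \<eta> = (if \<eta> \<in> configs K then lin c h \<eta> else 0)"

definition gen :: "(config \<Rightarrow> real) \<Rightarrow> config \<Rightarrow> real" where
  "gen f \<eta> = (\<Sum>p\<leftarrow>jumps \<eta>. fst p * (f (snd p) - f \<eta>))"

text \<open>The generator applied to \<open>lin c h\<close> without a cut, with the \<sigma> terms
  already cancelled. It is linear in the occupation numbers, which closes the equations for the
  first moments.\<close>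

definition drift :: "(nat \<Rightarrow> nat \<Rightarrow> real) \<Rightarrow> config \<Rightarrow> real" where
  "drift h \<eta> = (\<Sum>x=1..N. \<Sum>i\<in>{0,1}. real (\<eta> (x, i)) * site_generator N \<epsilon> \<gamma> h i x)
     + (\<Sum>i\<in>{0,1}. \<rho>L i * h i 1 + \<rho>R i * h i N)"

text \<open>Each birth rate is weighted by the value that the uncut function would have at the
  target; this is what is lost when a birth leaves level K. \<open>death_flux\<close> is the
  analogous gain when a death from level K + 1 enters the support.\<close>

definition birth_flux :: "real \<Rightarrow> (nat \<Rightarrow> nat \<Rightarrow> real) \<Rightarrow> config \<Rightarrow> real" where
  "birth_flux c h \<eta> = (\<Sum>i\<in>{0,1}.
       \<rho>L i * (1 + of_int \<sigma> * real (\<eta> (1, i))) * (lin c h \<eta> + h i 1)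
     + \<rho>R i * (1 + of_int \<sigma> * real (\<eta> (N, i))) * (lin c h \<eta> + h i N))"

definition death_flux :: "real \<Rightarrow> (nat \<Rightarrow> nat \<Rightarrow> real) \<Rightarrow> config \<Rightarrow> real" where
  "death_flux c h \<eta> = (\<Sum>i\<in>{0,1}.
       real (\<eta> (1, i)) * (1 + of_int \<sigma> * \<rho>L i) * (lin c h \<eta> - h i 1)
     + real (\<eta> (N, i)) * (1 + of_int \<sigma> * \<rho>R i) * (lin c h \<eta> - h i N))"

text \<open>\<open>rem_p\<close> does nothing on an empty site, and under exclusion an occupied site
  cannot receive a particle. A nonzero rate rules out both, so the list entry is a genuine
  move.\<close>

lemma move:
  assumes "valid \<eta>" "x \<in> {1..N}" "y \<in> {1..N}" "i \<in> {0,1}" "j \<in> {0,1}" "(x, i) \<noteq> (y, j)"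
    and "k * real (\<eta> (x, i)) * (1 + of_int \<sigma> * real (\<eta> (y, j))) \<noteq> 0"
  shows "valid (add_p (rem_p \<eta> (x, i)) (y, j))"
    and "total (add_p (rem_p \<eta> (x, i)) (y, j)) = total \<eta>"
    and "lin c h (add_p (rem_p \<eta> (x, i)) (y, j)) = lin c h \<eta> + (h j y - h i x)"
proof -
  have nz: "\<eta> (x, i) \<noteq> 0" and ex: "\<sigma> = -1 \<longrightarrow> \<eta> (y, j) = 0"
    using assms exclusion_empty[OF assms(1), of "(y, j)"] by auto
  have "rem_p \<eta> (x, i) (y, j) = \<eta> (y, j)" using assms(6) by (auto simp: rem_p_def)
  with ex show "valid (add_p (rem_p \<eta> (x, i)) (y, j))"
    using assms by (intro valid_add_p valid_rem_p) auto
  show "total (add_p (rem_p \<eta> (x, i)) (y, j)) = total \<eta>"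
    using total_add_p[OF assms(3,5)] total_rem_p[of x i \<eta>, OF assms(2,4) nz] by simp
  show "lin c h (add_p (rem_p \<eta> (x, i)) (y, j)) = lin c h \<eta> + (h j y - h i x)"
    using lin_add_p[OF assms(3,5)] lin_rem_p[of x i \<eta>, OF assms(2,4) nz] by simp
qed

text \<open>Hops and switches preserve the particle number, hence never cross the cut and produce no
  truncation error. Entries that are not genuine moves carry rate 0.\<close>

lemma move_term:
  assumes "valid \<eta>" "x \<in> {1..N}" "y \<in> {1..N}" "i \<in> {0,1}" "j \<in> {0,1}" "(x, i) \<noteq> (y, j)"
  shows "k * real (\<eta> (x, i)) * (1 + of_int \<sigma> * real (\<eta> (y, j))) *
      (trunc K c h (add_p (rem_p \<eta> (x, i)) (y, j)) - trunc K c h \<eta>) =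
      (if total \<eta> \<le> K then
        k * real (\<eta> (x, i)) * (1 + of_int \<sigma> * real (\<eta> (y, j))) * (h j y - h i x) else 0)"
proof (cases "k * real (\<eta> (x, i)) * (1 + of_int \<sigma> * real (\<eta> (y, j))) = 0")
  case False
  note m = move[OF assms False]
  show ?thesis unfolding trunc_def configs_def using m assms(1) by auto
qed (simp only:, simp)

text \<open>From level K the target lies above the cut, where the function is 0; the increment
  \<open>h i x\<close> must then be corrected by the whole uncut value at the target.\<close>

lemma birth_term:
  assumes "valid \<eta>" "x \<in> {1..N}" "i \<in> {0,1}"
  shows "k * (1 + of_int \<sigma> * real (\<eta> (x, i))) * (trunc K c h (add_p \<eta> (x, i)) - trunc K c h \<eta>) =
      (if total \<eta> \<le> K then k * (1 + of_int \<sigma> * real (\<eta> (x, i))) * h i x else 0)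
    - (if total \<eta> = K then k * (1 + of_int \<sigma> * real (\<eta> (x, i))) * (lin c h \<eta> + h i x) else 0)"
proof (cases "1 + of_int \<sigma> * real (\<eta> (x, i)) = 0")
  case False
  have "valid (add_p \<eta> (x, i))"
    using exclusion_empty[OF assms(1) False] assms by (intro valid_add_p) auto
  then show ?thesis
    unfolding trunc_def configs_def using assms(1) total_add_p[OF assms(2,3), of \<eta>] lin_add_p[OF assms(2,3), of c h \<eta>]
    by (auto simp: algebra_simps)
qed (simp only:, simp)

text \<open>From level K + 1 the source lies above the cut and the target does not, so the uncut
  value at the target appears.\<close>

lemma death_term:
  assumes "valid \<eta>" "x \<in> {1..N}" "i \<in> {0,1}"
  shows "real (\<eta> (x, i)) * k * (trunc K c h (rem_p \<eta> (x, i)) - trunc K c h \<eta>) =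
    - (if total \<eta> \<le> K then real (\<eta> (x, i)) * k * h i x else 0)
    + (if total \<eta> = K + 1 then real (\<eta> (x, i)) * k * (lin c h \<eta> - h i x) else 0)"
proof (cases "\<eta> (x, i) = 0")
  case False
  show ?thesis
    unfolding trunc_def configs_def lin_rem_p[of x i \<eta> c h, OF assms(2,3) False]
    using assms(1) valid_rem_p[OF assms(1)] total_rem_p[of x i \<eta>, OF assms(2,3) False]
    by (auto simp: algebra_simps)
qed simp

lemma drift_alt:
  "drift h \<eta> =
     (\<Sum>x=1..<N. \<Sum>i\<in>{0,1}. \<epsilon> ^ i * ((h i (x + 1) - h i x) * (real (\<eta> (x, i)) - real (\<eta> (x + 1, i)))))
   + (\<Sum>x=1..N. \<Sum>i\<in>{0,1}. \<gamma> * real (\<eta> (x, i)) * (h (1 - i) x - h i x))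
   + (\<Sum>i\<in>{0,1}. \<rho>L i * h i 1 + \<rho>R i * h i N)
   - (\<Sum>i\<in>{0,1}. real (\<eta> (1, i)) * h i 1 + real (\<eta> (N, i)) * h i N)"
proof -
  have parts: "(\<Sum>x=1..<N. \<Sum>i\<in>{0,1}. \<epsilon> ^ i * ((h i (x + 1) - h i x) * (real (\<eta> (x, i)) - real (\<eta> (x + 1, i)))))
     = (\<Sum>x=1..N. \<Sum>i\<in>{0,1}. \<epsilon> ^ i * (real (\<eta> (x, i)) * discrete_laplacian N (h i) x))"
  proof -
    have "(\<Sum>x=1..<N. e * ((h i (x + 1) - h i x) * (real (\<eta> (x, i)) - real (\<eta> (x + 1, i)))))
       = (\<Sum>x=1..N. e * (real (\<eta> (x, i)) * discrete_laplacian N (h i) x))" for i e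
      using summation_by_parts[of N "h i" "\<lambda>x. real (\<eta> (x, i))"] N2
      by (simp add: sum_distrib_left[symmetric])
    then show ?thesis by (subst (1 2) sum.swap) simp
  qed
  have ends: "(\<Sum>x=1..N. \<Sum>i\<in>{0,1}. (if x = 1 then real (\<eta> (x, i)) * h i x else 0)
        + (if x = N then real (\<eta> (x, i)) * h i x else 0))
     = (\<Sum>i\<in>{0,1}. real (\<eta> (1, i)) * h i 1 + real (\<eta> (N, i)) * h i N)"
    using N2 by (subst sum.swap) (simp add: sum.distrib)
  have "(\<Sum>x=1..N. \<Sum>i\<in>{0,1}. real (\<eta> (x, i)) * site_generator N \<epsilon> \<gamma> h i x) =
     (\<Sum>x=1..N. \<Sum>i\<in>{0,1}. \<epsilon> ^ i * (real (\<eta> (x, i)) * discrete_laplacian N (h i) x))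
     + (\<Sum>x=1..N. \<Sum>i\<in>{0,1}. \<gamma> * real (\<eta> (x, i)) * (h (1 - i) x - h i x))
     - (\<Sum>x=1..N. \<Sum>i\<in>{0,1}. (if x = 1 then real (\<eta> (x, i)) * h i x else 0)
        + (if x = N then real (\<eta> (x, i)) * h i x else 0))"
    unfolding sum.distrib[symmetric] sum_subtractf[symmetric] site_generator_def
    by (intro sum.cong) (auto simp: algebra_simps)
  then show ?thesis unfolding drift_def parts ends by simp
qed

text \<open>All dependence on the interaction disappears from the drift part; the cut is felt only
  at the two levels next to it.\<close>

lemma gen_trunc:
  assumes v: "valid \<eta>"
  shows "gen (trunc K c h) \<eta> =
      (if total \<eta> \<le> K then drift h \<eta> else 0)
    - (if total \<eta> = K then birth_flux c h \<eta> else 0)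
    + (if total \<eta> = K + 1 then death_flux c h \<eta> else 0)"
proof -
  let ?t = "trunc K c h"
  \<comment> \<open>The quadratic terms of the two opposite hops across a bond are equal up to sign;
    for switching the two layers at a site play the same role.\<close>
  have hop: "(\<Sum>x=1..<N. \<Sum>i\<in>{0,1}.
        \<epsilon> ^ i * real (\<eta> (x, i)) * (1 + of_int \<sigma> * real (\<eta> (x + 1, i)))
          * (?t (add_p (rem_p \<eta> (x, i)) (x + 1, i)) - ?t \<eta>)
      + \<epsilon> ^ i * real (\<eta> (x + 1, i)) * (1 + of_int \<sigma> * real (\<eta> (x, i)))
          * (?t (add_p (rem_p \<eta> (x + 1, i)) (x, i)) - ?t \<eta>)) =
      (if total \<eta> \<le> K then (\<Sum>x=1..<N. \<Sum>i\<in>{0,1}.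
        \<epsilon> ^ i * ((h i (x + 1) - h i x) * (real (\<eta> (x, i)) - real (\<eta> (x + 1, i))))) else 0)"
    by (auto simp: move_term[OF v] intro!: sum.cong) (simp_all add: algebra_simps)
  have switch: "(\<Sum>x=1..N. \<Sum>i\<in>{0,1}.
        \<gamma> * real (\<eta> (x, i)) * (1 + of_int \<sigma> * real (\<eta> (x, 1 - i)))
          * (?t (add_p (rem_p \<eta> (x, i)) (x, 1 - i)) - ?t \<eta>)) =
      (if total \<eta> \<le> K then (\<Sum>x=1..N. \<Sum>i\<in>{0,1}.
         \<gamma> * real (\<eta> (x, i)) * (h (1 - i) x - h i x)) else 0)"
    by (auto simp: move_term[OF v] intro!: sum.cong) (simp_all add: algebra_simps)
  have birth: "(\<Sum>i\<in>{0,1}.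
        \<rho>L i * (1 + of_int \<sigma> * real (\<eta> (1, i))) * (?t (add_p \<eta> (1, i)) - ?t \<eta>)
      + \<rho>R i * (1 + of_int \<sigma> * real (\<eta> (N, i))) * (?t (add_p \<eta> (N, i)) - ?t \<eta>)) =
      (if total \<eta> \<le> K then \<Sum>i\<in>{0,1}. \<rho>L i * (1 + of_int \<sigma> * real (\<eta> (1, i))) * h i 1
         + \<rho>R i * (1 + of_int \<sigma> * real (\<eta> (N, i))) * h i N else 0)
      - (if total \<eta> = K then birth_flux c h \<eta> else 0)"
    using N2 by (simp add: birth_term[OF v] birth_flux_def)
  have death: "(\<Sum>i\<in>{0,1}.
        real (\<eta> (1, i)) * (1 + of_int \<sigma> * \<rho>L i) * (?t (rem_p \<eta> (1, i)) - ?t \<eta>)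
      + real (\<eta> (N, i)) * (1 + of_int \<sigma> * \<rho>R i) * (?t (rem_p \<eta> (N, i)) - ?t \<eta>)) =
      - (if total \<eta> \<le> K then \<Sum>i\<in>{0,1}. real (\<eta> (1, i)) * (1 + of_int \<sigma> * \<rho>L i) * h i 1
         + real (\<eta> (N, i)) * (1 + of_int \<sigma> * \<rho>R i) * h i N else 0)
      + (if total \<eta> = K + 1 then death_flux c h \<eta> else 0)"
    using N2 by (simp add: death_term[OF v] death_flux_def)
  \<comment> \<open>The products \<sigma>\<rho>\<eta> occur in the birth rate and in the death rate
    of the same reservoir and cancel.\<close>
  have ends: "(\<Sum>i\<in>{0,1}. \<rho>L i * (1 + of_int \<sigma> * real (\<eta> (1, i))) * h i 1
         + \<rho>R i * (1 + of_int \<sigma> * real (\<eta> (N, i))) * h i N)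
     - (\<Sum>i\<in>{0,1}. real (\<eta> (1, i)) * (1 + of_int \<sigma> * \<rho>L i) * h i 1
         + real (\<eta> (N, i)) * (1 + of_int \<sigma> * \<rho>R i) * h i N)
     = (\<Sum>i\<in>{0,1}. \<rho>L i * h i 1 + \<rho>R i * h i N)
     - (\<Sum>i\<in>{0,1}. real (\<eta> (1, i)) * h i 1 + real (\<eta> (N, i)) * h i N)"
    by (simp add: algebra_simps)
  show ?thesis
    unfolding gen_def sum_transitions fst_conv snd_conv hop switch birth death drift_alt
    using ends by (simp split: if_splits)
qed

abbreviation "rate \<equiv> jump_rate \<sigma> N \<epsilon> \<gamma> \<rho>L \<rho>R"

text \<open>One jump removes at most one particle. Hence only finitely many configurations feed a
  given target.\<close>

lemma jump_rate_eq_0: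
  assumes v: "valid \<eta>" and t: "total \<eta> > total \<zeta> + 1"
  shows "rate \<eta> \<zeta> = 0"
proof -
  have "rate \<eta> \<zeta> = (\<Sum>p\<leftarrow>jumps \<eta>. if snd p = \<zeta> then fst p else 0)"
    unfolding jump_rate_def by (rule sum_list_map_filter')
  also have "\<dots> = 0"
  proof -
    have mv: "k * real (\<eta> (x, i)) * (1 + of_int \<sigma> * real (\<eta> (y, j))) = 0"
      if "x \<in> {1..N}" "y \<in> {1..N}" "i \<in> {0,1}" "j \<in> {0,1}" "(x, i) \<noteq> (y, j)"
        "add_p (rem_p \<eta> (x, i)) (y, j) = \<zeta>" for x y i j k
    proof (rule ccontr)
      assume "k * real (\<eta> (x, i)) * (1 + of_int \<sigma> * real (\<eta> (y, j))) \<noteq> 0"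
      from move(2)[OF v that(1-5) this] that(6) t show False by simp
    qed
    have birth_ne: "add_p \<eta> (x, i) \<noteq> \<zeta>" if "x \<in> {1..N}" "i \<in> {0,1}" for x i
      using total_add_p[OF that, of \<eta>] t by auto
    have death_0: "rem_p \<eta> (x, i) = \<zeta> \<longrightarrow> \<eta> (x, i) = 0" if "x \<in> {1..N}" "i \<in> {0,1}" for x i
      using total_rem_p[of x i \<eta>, OF that] t by fastforce
    have hop: "(\<Sum>x=1..<N. \<Sum>i\<in>{0,1}.
          (if add_p (rem_p \<eta> (x, i)) (x + 1, i) = \<zeta>
           then \<epsilon> ^ i * real (\<eta> (x, i)) * (1 + of_int \<sigma> * real (\<eta> (x + 1, i))) else 0)
        + (if add_p (rem_p \<eta> (x + 1, i)) (x, i) = \<zeta>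
           then \<epsilon> ^ i * real (\<eta> (x + 1, i)) * (1 + of_int \<sigma> * real (\<eta> (x, i))) else 0)) = 0"
    proof (intro sum.neutral ballI)
      fix x i :: nat assume "x \<in> {1..<N}" "i \<in> {0,1}"
      then show "(if add_p (rem_p \<eta> (x, i)) (x + 1, i) = \<zeta>
           then \<epsilon> ^ i * real (\<eta> (x, i)) * (1 + of_int \<sigma> * real (\<eta> (x + 1, i))) else 0)
        + (if add_p (rem_p \<eta> (x + 1, i)) (x, i) = \<zeta>
           then \<epsilon> ^ i * real (\<eta> (x + 1, i)) * (1 + of_int \<sigma> * real (\<eta> (x, i))) else 0) = 0"
        using mv[of x "x + 1" i i "\<epsilon> ^ i"] mv[of "x + 1" x i i "\<epsilon> ^ i"] by auto
    qed
    have switch: "(\<Sum>x=1..N. \<Sum>i\<in>{0,1}.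
          (if add_p (rem_p \<eta> (x, i)) (x, 1 - i) = \<zeta>
           then \<gamma> * real (\<eta> (x, i)) * (1 + of_int \<sigma> * real (\<eta> (x, 1 - i))) else 0)) = 0"
    proof (intro sum.neutral ballI)
      fix x i :: nat assume "x \<in> {1..N}" "i \<in> {0,1}"
      then show "(if add_p (rem_p \<eta> (x, i)) (x, 1 - i) = \<zeta>
           then \<gamma> * real (\<eta> (x, i)) * (1 + of_int \<sigma> * real (\<eta> (x, 1 - i))) else 0) = 0"
        using mv[of x x i "1 - i" \<gamma>] by auto
    qed
    show ?thesis
      unfolding sum_transitions fst_conv snd_conv hop switch
      using N2 death_0[of 1 0] death_0[of 1 1] death_0[of N 0] death_0[of N 1] by (simp add: birth_ne)
  qed
  finally show ?thesis .
qed

lemma pmf_invalid: "\<not> valid \<eta> \<Longrightarrow> pmf \<mu> \<eta> = 0"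
  using stationary by (auto simp: stationary_def set_pmf_eq)

text \<open>For a test function supported in \<open>configs K\<close> only sources in
  \<open>configs (K + 1)\<close> matter, so the sums over source and target are finite and may be
  exchanged.\<close>

lemma stationary_identity:
  assumes f: "\<And>\<eta>. \<eta> \<notin> configs K \<Longrightarrow> f \<eta> = 0"
  shows "(\<Sum>\<eta>\<in>configs (K + 1). pmf \<mu> \<eta> * gen f \<eta>) = 0"
proof -
  let ?C = "configs (K + 1)"
  have sub: "configs K \<subseteq> ?C" by (auto simp: configs_def)
  have bal: "(\<Sum>\<eta>\<in>?C. pmf \<mu> \<eta> * rate \<eta> \<zeta>) = pmf \<mu> \<zeta> * (\<Sum>p\<leftarrow>jumps \<zeta>. fst p)"
    if "\<zeta> \<in> configs K" for \<zeta>
  proof -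
    \<comment> \<open>An infinite sum that does not converge would be 0 by default. Here the terms
      vanish outside a finite set, so the balance equation has its intended content.\<close>
    have "pmf \<mu> \<eta> * rate \<eta> \<zeta> = 0" if "\<eta> \<notin> ?C" for \<eta>
      using pmf_invalid[of \<eta>] jump_rate_eq_0[of \<eta> \<zeta>] that \<open>\<zeta> \<in> configs K\<close>
      by (cases "valid \<eta>") (auto simp: configs_def)
    then have "(\<Sum>\<^sub>\<infinity>\<eta>. pmf \<mu> \<eta> * rate \<eta> \<zeta>) = (\<Sum>\<^sub>\<infinity>\<eta>\<in>?C. pmf \<mu> \<eta> * rate \<eta> \<zeta>)"
      by (intro infsum_cong_neutral) auto
    also have "\<dots> = (\<Sum>\<eta>\<in>?C. pmf \<mu> \<eta> * rate \<eta> \<zeta>)"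
      by (rule infsum_finite[OF finite_configs])
    finally show ?thesis
      using stationary by (simp add: stationary_def exit_rate_def)
  qed
  have "(\<Sum>\<eta>\<in>?C. pmf \<mu> \<eta> * (\<Sum>p\<leftarrow>jumps \<eta>. fst p * f (snd p))) =
     (\<Sum>\<eta>\<in>?C. pmf \<mu> \<eta> * (\<Sum>\<zeta>\<in>configs K. f \<zeta> * rate \<eta> \<zeta>))"
    unfolding jump_rate_def by (subst sum_list_filter_snd[OF finite_configs f]) auto
  also have "\<dots> = (\<Sum>\<zeta>\<in>configs K. f \<zeta> * (\<Sum>\<eta>\<in>?C. pmf \<mu> \<eta> * rate \<eta> \<zeta>))"
    unfolding sum_distrib_left by (subst sum.swap) (simp add: mult_ac)
  also have "\<dots> = (\<Sum>\<zeta>\<in>configs K. pmf \<mu> \<zeta> * (f \<zeta> * (\<Sum>p\<leftarrow>jumps \<zeta>. fst p)))"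
    by (intro sum.cong refl) (simp only: bal mult_ac)
  also have "\<dots> = (\<Sum>\<zeta>\<in>?C. pmf \<mu> \<zeta> * (f \<zeta> * (\<Sum>p\<leftarrow>jumps \<zeta>. fst p)))"
    using f by (intro sum.mono_neutral_left finite_configs sub) auto
  finally have "(\<Sum>\<eta>\<in>?C. pmf \<mu> \<eta> * (\<Sum>p\<leftarrow>jumps \<eta>. fst p * f (snd p))) =
     (\<Sum>\<eta>\<in>?C. pmf \<mu> \<eta> * (f \<eta> * (\<Sum>p\<leftarrow>jumps \<eta>. fst p)))" .
  moreover have "gen f \<eta> = (\<Sum>p\<leftarrow>jumps \<eta>. fst p * f (snd p)) - f \<eta> * (\<Sum>p\<leftarrow>jumps \<eta>. fst p)" for \<eta>
    by (simp add: gen_def right_diff_distrib sum_list_subtractf sum_list_mult_const)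
  ultimately show ?thesis by (simp add: right_diff_distrib sum_subtractf)
qed

definition level :: "nat \<Rightarrow> config set" where
  "level K = {\<eta>. valid \<eta> \<and> total \<eta> = K}"

lemma finite_level: "finite (level K)"
  by (rule finite_subset[OF _ finite_configs[of K]]) (auto simp: level_def configs_def)

text \<open>Finite version of the statement that the drift has mean 0, with an exact error. The left
  side does not contain \<open>c\<close>, so \<open>c\<close> may be chosen to suit the error
  terms.\<close>

lemma truncated_balance:
  "(\<Sum>\<eta>\<in>configs K. pmf \<mu> \<eta> * drift h \<eta>) =
     (\<Sum>\<eta>\<in>level K. pmf \<mu> \<eta> * birth_flux c h \<eta>)
   - (\<Sum>\<eta>\<in>level (K + 1). pmf \<mu> \<eta> * death_flux c h \<eta>)"
proof -
  let ?C = "configs (K + 1)"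
  have "0 = (\<Sum>\<eta>\<in>?C. pmf \<mu> \<eta> * gen (trunc K c h) \<eta>)"
    by (rule stationary_identity[symmetric]) (simp add: trunc_def)
  also have "\<dots> = (\<Sum>\<eta>\<in>?C. (if total \<eta> \<le> K then pmf \<mu> \<eta> * drift h \<eta> else 0)
       - (if total \<eta> = K then pmf \<mu> \<eta> * birth_flux c h \<eta> else 0)
       + (if total \<eta> = K + 1 then pmf \<mu> \<eta> * death_flux c h \<eta> else 0))"
    by (intro sum.cong) (auto simp: gen_trunc configs_def algebra_simps)
  also have "\<dots> = (\<Sum>\<eta>\<in>{\<eta>\<in>?C. total \<eta> \<le> K}. pmf \<mu> \<eta> * drift h \<eta>)
       - (\<Sum>\<eta>\<in>{\<eta>\<in>?C. total \<eta> = K}. pmf \<mu> \<eta> * birth_flux c h \<eta>)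
       + (\<Sum>\<eta>\<in>{\<eta>\<in>?C. total \<eta> = K + 1}. pmf \<mu> \<eta> * death_flux c h \<eta>)"
    by (simp add: sum.distrib sum_subtractf sum.inter_filter[OF finite_configs])
  also have "{\<eta>\<in>?C. total \<eta> \<le> K} = configs K" by (auto simp: configs_def)
  also have "{\<eta>\<in>?C. total \<eta> = K} = level K" by (auto simp: configs_def level_def)
  also have "{\<eta>\<in>?C. total \<eta> = K + 1} = level (K + 1)" by (auto simp: configs_def level_def)
  finally show ?thesis by simp
qed

section \<open>Summability of the boundary fluxes\<close>

definition end_count :: "config \<Rightarrow> real" where
  "end_count \<eta> = (\<Sum>i\<in>{0,1}. real (\<eta> (1, i)) + real (\<eta> (N, i)))"

definition birth :: "config \<Rightarrow> real" where
  "birth \<eta> = (\<Sum>i\<in>{0,1}. \<rho>L i * (1 + of_int \<sigma> * real (\<eta> (1, i)))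
     + \<rho>R i * (1 + of_int \<sigma> * real (\<eta> (N, i))))"

definition death :: "config \<Rightarrow> real" where
  "death \<eta> = (\<Sum>i\<in>{0,1}. real (\<eta> (1, i)) * (1 + of_int \<sigma> * \<rho>L i)
     + real (\<eta> (N, i)) * (1 + of_int \<sigma> * \<rho>R i))"

definition R :: real where "R = (\<Sum>i\<in>{0,1}. \<rho>L i + \<rho>R i)"

lemma R_nonneg: "0 \<le> R"
  unfolding R_def by (intro sum_nonneg add_nonneg_nonneg rhoL_nonneg rhoR_nonneg)

lemma death_nonneg: "0 \<le> death \<eta>"
  unfolding death_def
  by (intro sum_nonneg add_nonneg_nonneg mult_nonneg_nonneg reservoir_nonneg) auto

lemma death_le: "death \<eta> \<le> (1 + R) * end_count \<eta>"
proof -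
  have "1 + of_int \<sigma> * \<rho>L i \<le> 1 + R" "1 + of_int \<sigma> * \<rho>R i \<le> 1 + R" if i: "i \<in> {0,1}" for i
  proof -
    have "\<rho>L i \<le> R" "\<rho>R i \<le> R"
      using i rho_nonneg[of 0] rho_nonneg[of 1] unfolding R_def by auto
    then show "1 + of_int \<sigma> * \<rho>L i \<le> 1 + R" "1 + of_int \<sigma> * \<rho>R i \<le> 1 + R"
      using sigma rho_nonneg[OF i] R_nonneg by auto
  qed
  then have "death \<eta> \<le> (\<Sum>i\<in>{0,1}. real (\<eta> (1, i)) * (1 + R) + real (\<eta> (N, i)) * (1 + R))"
    unfolding death_def by (intro sum_mono add_mono mult_left_mono) auto
  then show ?thesis unfolding end_count_def by (simp add: algebra_simps)
qed

lemma truncated_mass: "(\<Sum>\<eta>\<in>configs K. pmf \<mu> \<eta>) \<le> 1"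
  unfolding measure_measure_pmf_finite[OF finite_configs, symmetric] by (rule measure_pmf.prob_le_1)

text \<open>Obtained from the constant 1 cut off above level K: in equilibrium the upward and
  downward flows between neighbouring levels agree. It lets \<open>D\<close> control the birth
  errors as well.\<close>

lemma level_balance:
  "(\<Sum>\<eta>\<in>level K. pmf \<mu> \<eta> * birth \<eta>) = (\<Sum>\<eta>\<in>level (K + 1). pmf \<mu> \<eta> * death \<eta>)"
proof -
  have "drift (\<lambda>_ _. 0) \<eta> = 0" for \<eta>
    by (simp add: drift_def site_generator_def discrete_laplacian_def)
  moreover have "birth_flux 1 (\<lambda>_ _. 0) \<eta> = birth \<eta>" "death_flux 1 (\<lambda>_ _. 0) \<eta> = death \<eta>" for \<eta>
    by (simp_all add: birth_flux_def death_flux_def birth_def death_def lin_def)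
  ultimately show ?thesis using truncated_balance[where h="\<lambda>_ _. 0" and c=1] by simp
qed

text \<open>The test function is the total particle number minus (K + 1), cut off above level K: its two
  truncation terms are a vanishing birth flux and a death flux of definite sign.\<close>

lemma truncated_end_count_eq:
  "(\<Sum>\<eta>\<in>configs K. pmf \<mu> \<eta> * (R - end_count \<eta>)) = (\<Sum>\<eta>\<in>level (K + 1). pmf \<mu> \<eta> * death \<eta>)"
proof -
  let ?c = "- (real K + 1)" and ?h = "\<lambda>_ _. 1 :: real"
  have d: "drift ?h \<eta> = R - end_count \<eta>" for \<eta>
    by (simp add: drift_alt R_def end_count_def)
  have l: "lin ?c ?h \<eta> = real (total \<eta>) - real K - 1" for \<eta>
    by (simp add: real_total lin_def)
  have b: "birth_flux ?c ?h \<eta> = 0" if "\<eta> \<in> level K" for \<eta>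
    using that unfolding birth_flux_def l by (simp add: level_def)
  have e: "death_flux ?c ?h \<eta> = - death \<eta>" if "\<eta> \<in> level (K + 1)" for \<eta>
    using that unfolding death_flux_def l by (simp add: level_def death_def)
  have "(\<Sum>\<eta>\<in>level K. pmf \<mu> \<eta> * birth_flux ?c ?h \<eta>) = 0"
    by (intro sum.neutral ballI) (simp only: b mult_zero_right)
  moreover have "(\<Sum>\<eta>\<in>level (K + 1). pmf \<mu> \<eta> * death_flux ?c ?h \<eta>)
      = - (\<Sum>\<eta>\<in>level (K + 1). pmf \<mu> \<eta> * death \<eta>)"
    unfolding sum_negf[symmetric] by (intro sum.cong refl) (simp only: e mult_minus_right)
  ultimately show ?thesis
    using truncated_balance[where K=K and h="?h" and c="?c"] unfolding d by simp
qed

text \<open>Dropping the nonnegative death flux leaves a bound uniform in the cut, obtained without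
  any knowledge of moments.\<close>

lemma truncated_end_count_le: "(\<Sum>\<eta>\<in>configs K. pmf \<mu> \<eta> * end_count \<eta>) \<le> R"
proof -
  have "0 \<le> (\<Sum>\<eta>\<in>level (K + 1). pmf \<mu> \<eta> * death \<eta>)"
    by (intro sum_nonneg mult_nonneg_nonneg death_nonneg) auto
  then have "(\<Sum>\<eta>\<in>configs K. pmf \<mu> \<eta> * end_count \<eta>) \<le> (\<Sum>\<eta>\<in>configs K. pmf \<mu> \<eta>) * R"
    unfolding truncated_end_count_eq[symmetric]
    by (simp add: right_diff_distrib sum_subtractf sum_distrib_right)
  also have "\<dots> \<le> 1 * R" by (intro mult_right_mono truncated_mass R_nonneg)
  finally show ?thesis by simp
qed

text \<open>Stationary rate of falling from level k to the level below.\<close>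

definition D :: "nat \<Rightarrow> real" where
  "D k = (\<Sum>\<eta>\<in>level k. pmf \<mu> \<eta> * death \<eta>)"

lemma D_nonneg: "0 \<le> D k"
  unfolding D_def by (intro sum_nonneg mult_nonneg_nonneg death_nonneg) auto

text \<open>The levels are disjoint and together fill \<open>configs n\<close>. Deaths occur only at
  the end sites, so the partial sums are governed by the end occupation, not by the total particle
  number.\<close>

lemma summable_D: "summable D"
proof (rule summableI_nonneg_bounded)
  fix n
  have "(\<Sum>k<n. D k) \<le> (\<Sum>k\<le>n. D k)"
    by (intro sum_mono2) (auto simp: D_nonneg)
  also have "\<dots> = (\<Sum>\<eta>\<in>(\<Union>k\<le>n. level k). pmf \<mu> \<eta> * death \<eta>)"
    unfolding D_def by (subst sum.UNION_disjoint) (simp_all add: finite_level, auto simp: level_def)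
  also have "(\<Union>k\<le>n. level k) = configs n" by (auto simp: level_def configs_def)
  also have "(\<Sum>\<eta>\<in>configs n. pmf \<mu> \<eta> * death \<eta>) \<le> (\<Sum>\<eta>\<in>configs n. pmf \<mu> \<eta> * ((1 + R) * end_count \<eta>))"
    by (intro sum_mono mult_left_mono death_le) auto
  also have "\<dots> = (1 + R) * (\<Sum>\<eta>\<in>configs n. pmf \<mu> \<eta> * end_count \<eta>)"
    by (simp add: sum_distrib_left mult_ac)
  also have "\<dots> \<le> (1 + R) * R"
    using R_nonneg by (intro mult_left_mono truncated_end_count_le) auto
  finally show "(\<Sum>k<n. D k) \<le> (1 + R) * R" .
qed (rule D_nonneg)

end

section \<open>Integrability and the closed equations for the profile\<close>

text \<open>Otherwise a tail of \<open>D\<close> would dominate a multiple of the harmonic series.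
  Only a subsequence is obtained, since summability does not force \<open>K * D K\<close> to tend to
  0.\<close>

lemma summable_frequently_small:
  fixes D :: "nat \<Rightarrow> real"
  assumes "summable D" "0 < \<delta>"
  shows "\<exists>K\<ge>n. real (K + 1) * D K < \<delta>"
proof (rule ccontr)
  assume "\<not> ?thesis"
  then have "\<delta> / real (Suc K) \<le> D K" if "K \<ge> n" for K
    using that by (force simp: field_simps not_less)
  then have "summable (\<lambda>K. \<delta> / real (Suc K))"
    using assms by (intro summable_comparison_test'[OF assms(1), of n]) auto
  then have "summable (\<lambda>K. inverse (real (Suc K)))"
    using assms(2) summable_mult[of "\<lambda>K. \<delta> / real (Suc K)" "1 / \<delta>"] by (simp add: field_simps)
  then show False
    using not_summable_harmonic[where 'a=real] summable_Suc_iff[of "\<lambda>n. inverse (real n)"] by blast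
qed

lemma abs_weighted_sum_le:
  fixes a b u v :: "nat \<Rightarrow> real"
  assumes "\<And>i. i \<in> I \<Longrightarrow> 0 \<le> a i" "\<And>i. i \<in> I \<Longrightarrow> 0 \<le> b i"
    and "\<And>i. i \<in> I \<Longrightarrow> \<bar>u i\<bar> \<le> M" "\<And>i. i \<in> I \<Longrightarrow> \<bar>v i\<bar> \<le> M"
  shows "\<bar>\<Sum>i\<in>I. a i * u i + b i * v i\<bar> \<le> M * (\<Sum>i\<in>I. a i + b i)"
proof -
  have "\<bar>\<Sum>i\<in>I. a i * u i + b i * v i\<bar> \<le> (\<Sum>i\<in>I. \<bar>a i * u i + b i * v i\<bar>)" by (rule sum_abs)
  also have "\<dots> \<le> (\<Sum>i\<in>I. a i * M + b i * M)"
  proof (rule sum_mono)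
    fix i assume i: "i \<in> I"
    have "\<bar>a i * u i + b i * v i\<bar> \<le> \<bar>a i * u i\<bar> + \<bar>b i * v i\<bar>" by (rule abs_triangle_ineq)
    also have "\<dots> \<le> a i * M + b i * M"
      unfolding abs_mult using assms i by (intro add_mono mult_mono) auto
    finally show "\<bar>a i * u i + b i * v i\<bar> \<le> a i * M + b i * M" .
  qed
  finally show ?thesis by (simp add: sum_distrib_left algebra_simps)
qed

context boundary_driven
begin

lemma abs_lin_le:
  assumes h: "\<And>i x. i \<in> {0,1} \<Longrightarrow> x \<in> {1..N} \<Longrightarrow> \<bar>h i x\<bar> \<le> C"
  shows "\<bar>lin 0 h \<eta>\<bar> \<le> C * real (total \<eta>)"
proof -
  have "\<bar>lin 0 h \<eta>\<bar> \<le> (\<Sum>x=1..N. \<Sum>i\<in>{0,1}. \<bar>h i x * real (\<eta> (x, i))\<bar>)"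
    unfolding lin_def add_0 by (rule order_trans[OF sum_abs], rule sum_mono, rule sum_abs)
  also have "\<dots> \<le> (\<Sum>x=1..N. \<Sum>i\<in>{0,1}. C * real (\<eta> (x, i)))"
    using h by (intro sum_mono) (auto simp: abs_mult intro!: mult_right_mono)
  also have "\<dots> = C * real (total \<eta>)"
    unfolding total_def by (simp add: sum_distrib_left algebra_simps)
  finally show ?thesis .
qed

text \<open>On level K + 1 a linear function is at most C(K + 1) and one jump adds at most C, whence
  K + 2. The factor 2 counts births and deaths, which have the same total flow by
  \<open>level_balance\<close>.\<close>

lemma truncated_drift_le:
  assumes h: "\<And>i x. i \<in> {0,1} \<Longrightarrow> x \<in> {1..N} \<Longrightarrow> \<bar>h i x\<bar> \<le> C"
  shows "\<bar>\<Sum>\<eta>\<in>configs K. pmf \<mu> \<eta> * drift h \<eta>\<bar> \<le> 2 * C * (real K + 2) * D (K + 1)"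
proof -
  have h1: "\<bar>h i 1\<bar> \<le> C" "\<bar>h i N\<bar> \<le> C" if "i \<in> {0,1}" for i
    using h[OF that, of 1] h[OF that, of N] N2 by auto
  have C: "0 \<le> C" using h1[of 0] by auto
  have b: "\<bar>birth_flux 0 h \<eta>\<bar> \<le> C * (real K + 2) * birth \<eta>" if "\<eta> \<in> level K" for \<eta>
    unfolding birth_flux_def birth_def
  proof (rule abs_weighted_sum_le)
    fix i :: nat assume i: "i \<in> {0,1}"
    have v: "valid \<eta>" using that by (simp add: level_def)
    show "0 \<le> \<rho>L i * (1 + of_int \<sigma> * real (\<eta> (1, i)))" "0 \<le> \<rho>R i * (1 + of_int \<sigma> * real (\<eta> (N, i)))"
      by (intro mult_nonneg_nonneg rhoL_nonneg rhoR_nonneg exclusion_nonneg i v)+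
    have "\<bar>lin 0 h \<eta>\<bar> \<le> C * real K"
      using abs_lin_le[OF h, where \<eta>=\<eta>] that by (simp add: level_def)
    then show "\<bar>lin 0 h \<eta> + h i 1\<bar> \<le> C * (real K + 2)" "\<bar>lin 0 h \<eta> + h i N\<bar> \<le> C * (real K + 2)"
      using h1[OF i] C by (auto simp: algebra_simps)
  qed
  have d: "\<bar>death_flux 0 h \<eta>\<bar> \<le> C * (real K + 2) * death \<eta>" if "\<eta> \<in> level (K + 1)" for \<eta>
    unfolding death_flux_def death_def
  proof (rule abs_weighted_sum_le)
    fix i :: nat assume i: "i \<in> {0,1}"
    show "0 \<le> real (\<eta> (1, i)) * (1 + of_int \<sigma> * \<rho>L i)" "0 \<le> real (\<eta> (N, i)) * (1 + of_int \<sigma> * \<rho>R i)"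
      by (intro mult_nonneg_nonneg reservoir_nonneg i of_nat_0_le_iff)+
    have "\<bar>lin 0 h \<eta>\<bar> \<le> C * (real K + 1)"
      using abs_lin_le[OF h, where \<eta>=\<eta>] that by (simp add: level_def add.commute)
    then show "\<bar>lin 0 h \<eta> - h i 1\<bar> \<le> C * (real K + 2)" "\<bar>lin 0 h \<eta> - h i N\<bar> \<le> C * (real K + 2)"
      using h1[OF i] C by (auto simp: algebra_simps)
  qed
  have "\<bar>\<Sum>\<eta>\<in>level K. pmf \<mu> \<eta> * birth_flux 0 h \<eta>\<bar>
      \<le> (\<Sum>\<eta>\<in>level K. pmf \<mu> \<eta> * (C * (real K + 2) * birth \<eta>))"
    by (rule order_trans[OF sum_abs], rule sum_mono) (simp add: abs_mult b mult_left_mono)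
  also have "\<dots> = C * (real K + 2) * D (K + 1)"
    unfolding D_def level_balance[symmetric] by (simp add: sum_distrib_left mult_ac)
  finally have B: "\<bar>\<Sum>\<eta>\<in>level K. pmf \<mu> \<eta> * birth_flux 0 h \<eta>\<bar> \<le> C * (real K + 2) * D (K + 1)" .
  have "\<bar>\<Sum>\<eta>\<in>level (K + 1). pmf \<mu> \<eta> * death_flux 0 h \<eta>\<bar>
      \<le> (\<Sum>\<eta>\<in>level (K + 1). pmf \<mu> \<eta> * (C * (real K + 2) * death \<eta>))"
    by (rule order_trans[OF sum_abs], rule sum_mono)
      (simp add: abs_mult d[unfolded Suc_eq_plus1[symmetric]] mult_left_mono)
  also have "\<dots> = C * (real K + 2) * D (K + 1)"
    unfolding D_def by (simp add: sum_distrib_left mult_ac)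
  finally show ?thesis
    using B truncated_balance[where K=K and h=h and c=0] by (simp add: algebra_simps)
qed

lemma truncated_drift_frequently_small:
  assumes "0 < \<delta>"
  shows "\<exists>K\<ge>n. \<bar>\<Sum>\<eta>\<in>configs K. pmf \<mu> \<eta> * drift h \<eta>\<bar> < \<delta>"
proof -
  define C where "C = (\<Sum>x=1..N. \<Sum>i\<in>{0,1}. \<bar>h i x\<bar>) + 1"
  have C: "\<bar>h i x\<bar> \<le> C" if "i \<in> {0,1}" "x \<in> {1..N}" for i x
  proof -
    have "\<bar>h i x\<bar> \<le> (\<Sum>i\<in>{0,1}. \<bar>h i x\<bar>)"
      by (rule member_le_sum[OF that(1), of "\<lambda>i. \<bar>h i x\<bar>"]) auto
    also have "\<dots> \<le> (\<Sum>x=1..N. \<Sum>i\<in>{0,1}. \<bar>h i x\<bar>)"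
      by (rule member_le_sum[OF that(2), of "\<lambda>x. \<Sum>i\<in>{0,1}. \<bar>h i x\<bar>"]) auto
    finally show ?thesis by (simp add: C_def)
  qed
  have C0: "0 < C" unfolding C_def by (intro add_nonneg_pos sum_nonneg) auto
  \<comment> \<open>The bound for the cut at K involves \<open>D (K + 1)\<close>; asking for
    \<open>k \<ge> Suc n\<close> makes the predecessor of \<open>k\<close> an admissible
    cut.\<close>
  obtain k where k: "k \<ge> Suc n" "real (k + 1) * D k < \<delta> / (2 * C)"
    using summable_frequently_small[OF summable_D, of "\<delta> / (2 * C)" "Suc n"] assms C0 by auto
  obtain K where K: "k = K + 1" using k(1) by (cases k) auto
  have "\<bar>\<Sum>\<eta>\<in>configs K. pmf \<mu> \<eta> * drift h \<eta>\<bar> \<le> 2 * C * (real K + 2) * D (K + 1)"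
    by (rule truncated_drift_le[OF C])
  also have "\<dots> < \<delta>" using k(2) C0 unfolding K by (simp add: field_simps)
  finally show ?thesis using k(1) K by auto
qed

text \<open>For the barrier the drift is at most a constant, the reservoir input, minus the particle
  number. A mean drift close to 0 then bounds the mean particle number.\<close>

lemma truncated_total_bounded: "\<exists>M. \<forall>K. (\<Sum>\<eta>\<in>configs K. pmf \<mu> \<eta> * real (total \<eta>)) \<le> M"
proof -
  let ?h = "barrier N \<gamma>"
  define c where "c = (\<Sum>i\<in>{0,1}. \<rho>L i * ?h i 1 + \<rho>R i * ?h i N)"
  have c: "0 \<le> c"
    unfolding c_def using N2 gamma
    by (intro sum_nonneg add_nonneg_nonneg mult_nonneg_nonneg rhoL_nonneg rhoR_nonneg barrier_nonneg) auto
  have dr: "drift ?h \<eta> \<le> c - real (total \<eta>)" for \<eta>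
  proof -
    have "(\<Sum>x=1..N. \<Sum>i\<in>{0,1}. real (\<eta> (x, i)) * site_generator N \<epsilon> \<gamma> ?h i x)
        \<le> (\<Sum>x=1..N. \<Sum>i\<in>{0,1}. real (\<eta> (x, i)) * (-1))"
      by (intro sum_mono mult_left_mono site_generator_barrier N2 eps gamma) auto
    also have "\<dots> = - real (total \<eta>)"
      unfolding total_def by (simp add: sum_negf[symmetric])
    finally show ?thesis unfolding drift_def c_def by simp
  qed
  have "(\<Sum>\<eta>\<in>configs n. pmf \<mu> \<eta> * real (total \<eta>)) \<le> c + 1" for n
  proof -
    \<comment> \<open>The truncated means grow with the cut, so a bound at a single good level above
      \<open>n\<close> also covers \<open>n\<close>.\<close>
    obtain K where K: "K \<ge> n" "\<bar>\<Sum>\<eta>\<in>configs K. pmf \<mu> \<eta> * drift ?h \<eta>\<bar> < 1"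
      using truncated_drift_frequently_small[of 1 n ?h] by auto
    have "(\<Sum>\<eta>\<in>configs n. pmf \<mu> \<eta> * real (total \<eta>)) \<le> (\<Sum>\<eta>\<in>configs K. pmf \<mu> \<eta> * real (total \<eta>))"
      using K(1) by (intro sum_mono2 finite_configs) (auto simp: configs_def)
    also have "\<dots> \<le> (\<Sum>\<eta>\<in>configs K. pmf \<mu> \<eta> * (c - drift ?h \<eta>))"
      by (intro sum_mono mult_left_mono) (use dr in \<open>auto simp: algebra_simps\<close>)
    also have "\<dots> = (\<Sum>\<eta>\<in>configs K. pmf \<mu> \<eta>) * c - (\<Sum>\<eta>\<in>configs K. pmf \<mu> \<eta> * drift ?h \<eta>)"
      by (simp add: right_diff_distrib sum_subtractf sum_distrib_right)
    also have "\<dots> \<le> 1 * c - (- 1)"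
      using K(2) by (intro diff_mono mult_right_mono truncated_mass c) linarith
    finally show ?thesis by simp
  qed
  then show ?thesis by blast
qed

lemma integral_truncated:
  "(\<integral>\<eta>. indicator (configs K) \<eta> * g \<eta> \<partial>measure_pmf \<mu>) = (\<Sum>\<eta>\<in>configs K. pmf \<mu> \<eta> * g \<eta>)"
  by (subst integral_measure_pmf_real[OF finite_configs])
    (auto simp: indicator_def mult.commute intro!: sum.cong split: if_splits)

lemma AE_truncation_tendsto:
  "AE \<eta> in measure_pmf \<mu>. (\<lambda>K. indicator (configs K) \<eta> * g \<eta>) \<longlonglongrightarrow> (g \<eta> :: real)"
proof (rule AE_pmfI)
  fix \<eta> assume "\<eta> \<in> set_pmf \<mu>"
  then have "valid \<eta>" using stationary by (auto simp: stationary_def)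
  then have "eventually (\<lambda>K. indicator (configs K) \<eta> * g \<eta> = g \<eta>) sequentially"
    by (intro eventually_sequentiallyI[of "total \<eta>"]) (simp add: configs_def)
  then show "(\<lambda>K. indicator (configs K) \<eta> * g \<eta>) \<longlonglongrightarrow> g \<eta>" by (rule tendsto_eventually)
qed

text \<open>Monotone convergence along the cuts, which exhaust the valid configurations and hence
  the support of the measure.\<close>

lemma integrable_total: "integrable (measure_pmf \<mu>) (\<lambda>\<eta>. real (total \<eta>))"
proof -
  let ?I = "\<lambda>K. \<integral>\<eta>. indicator (configs K) \<eta> * real (total \<eta>) \<partial>measure_pmf \<mu>"
  obtain M where M: "?I K \<le> M" for K
    using truncated_total_bounded unfolding integral_truncated by blast
  have int: "integrable (measure_pmf \<mu>) (\<lambda>\<eta>. indicator (configs K) \<eta> * real (total \<eta>))" for K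
    by (rule measure_pmf.integrable_const_bound[where B="real K"])
      (auto simp: configs_def indicator_def)
  have mono: "mono (\<lambda>K. indicator (configs K) \<eta> * real (total \<eta>))" for \<eta>
    by (intro monoI mult_right_mono) (auto simp: configs_def indicator_def)
  have "incseq ?I"
    by (intro monoI integral_mono int monoD[OF mono])
  then obtain l where "?I \<longlonglongrightarrow> l" using incseq_convergent M by blast
  then show ?thesis
    by (intro integrable_monotone_convergence[OF int _ AE_truncation_tendsto]) (auto simp: mono)
qed

lemma integrable_occupation:
  assumes "x \<in> {1..N}" "i \<in> {0,1}"
  shows "integrable (measure_pmf \<mu>) (\<lambda>\<eta>. real (\<eta> (x, i)))"
proof (rule Bochner_Integration.integrable_bound[OF integrable_total])
  show "AE \<eta> in measure_pmf \<mu>. norm (real (\<eta> (x, i))) \<le> norm (real (total \<eta>))"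
  proof (rule AE_I2)
    fix \<eta> :: config
    have "\<eta> (x, i) \<le> (\<Sum>i\<in>{0,1}. \<eta> (x, i))"
      by (rule member_le_sum[OF assms(2), of "\<lambda>i. \<eta> (x, i)"]) auto
    also have "\<dots> \<le> total \<eta>"
      unfolding total_def
      by (rule member_le_sum[OF assms(1), of "\<lambda>x. \<Sum>i\<in>{0,1}. \<eta> (x, i)"]) auto
    finally show "norm (real (\<eta> (x, i))) \<le> norm (real (total \<eta>))" by simp
  qed
qed simp

lemma integrable_drift: "integrable (measure_pmf \<mu>) (drift h)"
  unfolding drift_def
  by (intro Bochner_Integration.integrable_add Bochner_Integration.integrable_sum
      integrable_mult_left integrable_occupation) auto

text \<open>Dominated convergence now makes the truncated means converge along all cuts; since they
  are arbitrarily small along some of them, the limit is 0.\<close>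

lemma expectation_drift: "measure_pmf.expectation \<mu> (drift h) = 0"
proof -
  have lim: "(\<lambda>K. \<integral>\<eta>. indicator (configs K) \<eta> * drift h \<eta> \<partial>measure_pmf \<mu>)
      \<longlonglongrightarrow> measure_pmf.expectation \<mu> (drift h)"
    by (rule integral_dominated_convergence[where w="\<lambda>\<eta>. \<bar>drift h \<eta>\<bar>", OF _ _ _ AE_truncation_tendsto])
      (auto simp: integrable_drift indicator_def)
  show ?thesis
  proof (rule ccontr)
    assume "\<not> ?thesis"
    then have pos: "0 < \<bar>measure_pmf.expectation \<mu> (drift h)\<bar> / 2" by simp
    have "eventually (\<lambda>K. \<bar>measure_pmf.expectation \<mu> (drift h)\<bar> / 2
        < \<bar>\<Sum>\<eta>\<in>configs K. pmf \<mu> \<eta> * drift h \<eta>\<bar>) sequentially"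
      using tendsto_rabs[OF lim] pos unfolding integral_truncated
      by (intro order_tendstoD(1)) auto
    then obtain n where "\<And>K. K \<ge> n \<Longrightarrow> \<bar>measure_pmf.expectation \<mu> (drift h)\<bar> / 2
        < \<bar>\<Sum>\<eta>\<in>configs K. pmf \<mu> \<eta> * drift h \<eta>\<bar>"
      by (auto simp: eventually_sequentially)
    with truncated_drift_frequently_small[OF pos, of n h] show False by force
  qed
qed

lemma profile_equation:
  assumes i: "i \<in> {0,1}" and x: "x \<in> {1..N}"
  shows "site_generator N \<epsilon> \<gamma> (profile \<mu>) i x
     + (if x = 1 then \<rho>L i else 0) + (if x = N then \<rho>R i else 0) = 0"
proof -
  \<comment> \<open>The indicator of one site and layer: after the symmetry of
    \<open>site_generator\<close> is used, it selects a single equation of the system.\<close>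
  define h :: "nat \<Rightarrow> nat \<Rightarrow> real" where "h j y = (if j = i \<and> y = x then 1 else 0)" for j y
  have "0 = measure_pmf.expectation \<mu> (drift h)" by (simp add: expectation_drift)
  also have "\<dots> = (\<Sum>y=1..N. \<Sum>j\<in>{0,1}. profile \<mu> j y * site_generator N \<epsilon> \<gamma> h j y)
      + (\<Sum>j\<in>{0,1}. \<rho>L j * h j 1 + \<rho>R j * h j N)"
  proof -
    have int: "integrable (measure_pmf \<mu>) (\<lambda>\<eta>. real (\<eta> (y, j)) * c)"
      if "y \<in> {1..N}" "j \<in> {0,1}" for y j c
      by (intro integrable_mult_left integrable_occupation that)
    have "measure_pmf.expectation \<mu>
        (\<lambda>\<eta>. \<Sum>y=1..N. \<Sum>j\<in>{0,1}. real (\<eta> (y, j)) * site_generator N \<epsilon> \<gamma> h j y)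
      = (\<Sum>y=1..N. \<Sum>j\<in>{0,1}. profile \<mu> j y * site_generator N \<epsilon> \<gamma> h j y)"
      unfolding profile_def
      by (subst Bochner_Integration.integral_sum, (intro Bochner_Integration.integrable_sum int; assumption),
          intro sum.cong refl, subst Bochner_Integration.integral_sum, (intro int; assumption)) simp
    moreover have "integrable (measure_pmf \<mu>)
        (\<lambda>\<eta>. \<Sum>y=1..N. \<Sum>j\<in>{0,1}. real (\<eta> (y, j)) * site_generator N \<epsilon> \<gamma> h j y)"
      by (intro Bochner_Integration.integrable_sum int)
    ultimately show ?thesis
      unfolding drift_def by (subst Bochner_Integration.integral_add) simp_all
  qed
  also have "(\<Sum>y=1..N. \<Sum>j\<in>{0,1}. profile \<mu> j y * site_generator N \<epsilon> \<gamma> h j y)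
      = (\<Sum>y=1..N. \<Sum>j\<in>{0,1}. h j y * site_generator N \<epsilon> \<gamma> (profile \<mu>) j y)"
    using N2 by (intro site_generator_symmetric) simp
  also have "\<dots> = (\<Sum>y=1..N. if y = x then site_generator N \<epsilon> \<gamma> (profile \<mu>) i x else 0)"
    using i by (intro sum.cong) (auto simp: h_def)
  also have "\<dots> = site_generator N \<epsilon> \<gamma> (profile \<mu>) i x" using x by simp
  also have "(\<Sum>j\<in>{0,1}. \<rho>L j * h j 1 + \<rho>R j * h j N) =
      (if x = 1 then \<rho>L i else 0) + (if x = N then \<rho>R i else 0)"
    using i by (auto simp: h_def)
  finally show ?thesis by simp
qed

end

section \<open>Stability of the discrete system\<close>

definition residual ::
  "nat \<Rightarrow> real \<Rightarrow> real \<Rightarrow> (nat \<Rightarrow> real) \<Rightarrow> (nat \<Rightarrow> real) \<Rightarrow> (nat \<Rightarrow> nat \<Rightarrow> real) \<Rightarrow> nat \<Rightarrow> nat \<Rightarrow> real" where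
  "residual N \<epsilon> \<gamma> \<rho>L \<rho>R w i x = site_generator N \<epsilon> \<gamma> w i x
     + (if x = 1 then \<rho>L i else 0) + (if x = N then \<rho>R i else 0)"

text \<open>The stationary profile has residual 0, so the reservoir terms drop out of the difference
  and the comparison bound applies to it.\<close>

lemma (in boundary_driven) profile_approximation:
  assumes small: "\<And>i x. i \<in> {0,1} \<Longrightarrow> x \<in> {1..N} \<Longrightarrow>
        \<bar>residual N \<epsilon> \<gamma> \<rho>L \<rho>R w i x\<bar> < \<delta> * ((if x = 1 \<or> x = N then 1 else 0) + 1 / (real N)\<^sup>2)"
    and del: "0 < \<delta>" and i: "i \<in> {0,1}" and x: "x \<in> {1..N}"
  shows "\<bar>profile \<mu> i x - w i x\<bar> \<le> \<delta> * (2 + 1 / (\<gamma> * (real N)\<^sup>2))"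
proof (rule site_generator_comparison[where e="\<lambda>i x. profile \<mu> i x - w i x", OF N2 eps gamma del _ i x])
  fix j y assume j: "j \<in> {0,1::nat}" and y: "y \<in> {1..N}"
  have "site_generator N \<epsilon> \<gamma> (\<lambda>i x. profile \<mu> i x - w i x) j y =
     site_generator N \<epsilon> \<gamma> (profile \<mu>) j y - site_generator N \<epsilon> \<gamma> w j y"
    unfolding site_generator_def discrete_laplacian_def by (simp add: algebra_simps)
  also have "\<dots> = - residual N \<epsilon> \<gamma> \<rho>L \<rho>R w j y"
    using profile_equation[OF j y] unfolding residual_def by linarith
  finally show "\<bar>site_generator N \<epsilon> \<gamma> (\<lambda>i x. profile \<mu> i x - w i x) j y\<bar>
      < \<delta> * ((if y = 1 \<or> y = N then 1 else 0) + 1 / (real N)\<^sup>2)"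
    using small[OF j y] by simp
qed

lemma eventually_profile_approximation:
  fixes \<gamma> :: "nat \<Rightarrow> real"
  assumes chain: "\<And>N. 2 \<le> N \<Longrightarrow> boundary_driven \<sigma> N \<epsilon> (\<gamma> N) \<rho>L \<rho>R (\<mu> N)"
    and lim: "(\<lambda>N. \<gamma> N * (real N)\<^sup>2) \<longlonglongrightarrow> \<Upsilon>" and Ups: "0 < \<Upsilon>"
    and small: "\<And>\<delta>. 0 < \<delta> \<Longrightarrow> \<forall>\<^sub>F N in sequentially. \<forall>i\<in>{0,1}. \<forall>x\<in>{1..N}.
        \<bar>residual N \<epsilon> (\<gamma> N) \<rho>L \<rho>R (w N) i x\<bar>
          < \<delta> * ((if x = 1 \<or> x = N then 1 else 0) + 1 / (real N)\<^sup>2)"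
    and e: "0 < e"
  shows "\<forall>\<^sub>F N in sequentially. \<forall>i\<in>{0,1}. \<forall>x\<in>{1..N}. \<bar>profile (\<mu> N) i x - w N i x\<bar> < e"
proof -
  \<comment> \<open>Chosen so that \<delta>(3 + 1/\<Upsilon>) = e; eventually 1/(\<gamma> N^2) is
    below 1/\<Upsilon> + 1, and the comparison bound contributes a further 2.\<close>
  define \<delta> where "\<delta> = e / (3 + 1 / \<Upsilon>)"
  have del: "0 < \<delta>" using e Ups by (simp add: \<delta>_def add_pos_pos)
  have "(\<lambda>N. 1 / (\<gamma> N * (real N)\<^sup>2)) \<longlonglongrightarrow> 1 / \<Upsilon>"
    using lim Ups by (intro tendsto_intros) auto
  then have "\<forall>\<^sub>F N in sequentially. 1 / (\<gamma> N * (real N)\<^sup>2) < 1 / \<Upsilon> + 1"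
    by (rule order_tendstoD) simp
  with small[OF del] eventually_ge_at_top[of 2] show ?thesis
  proof eventually_elim
    case (elim N)
    interpret boundary_driven \<sigma> N \<epsilon> "\<gamma> N" \<rho>L \<rho>R "\<mu> N" by (rule chain[OF elim(2)])
    show ?case
    proof (intro ballI)
      fix i x assume "i \<in> {0,1::nat}" "x \<in> {1..N}"
      then have "\<bar>profile (\<mu> N) i x - w N i x\<bar> \<le> \<delta> * (2 + 1 / (\<gamma> N * (real N)\<^sup>2))"
      proof (intro profile_approximation del)
        fix j y assume "j \<in> {0,1::nat}" "y \<in> {1..N}"
        with elim(1) show "\<bar>residual N \<epsilon> (\<gamma> N) \<rho>L \<rho>R (w N) j y\<bar>
            < \<delta> * ((if y = 1 \<or> y = N then 1 else 0) + 1 / (real N)\<^sup>2)" by blast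
      qed
      also have "\<dots> < \<delta> * (3 + 1 / \<Upsilon>)"
        using elim(3) del by (intro mult_strict_left_mono) auto
      also have "\<dots> = e"
      proof -
        have "0 < 3 + 1 / \<Upsilon>" using Ups by (simp add: add_pos_pos)
        then show ?thesis unfolding \<delta>_def by simp
      qed
      finally show "\<bar>profile (\<mu> N) i x - w N i x\<bar> < e" .
    qed
  qed
qed

text \<open>Reservoir values at the ghost sites 0 and N + 1 complete the second difference. Hopping
  would couple to them at speed \<epsilon>^i, the reservoirs act at speed 1; the end terms are this
  mismatch, absent in layer 0.\<close>

lemma residual_boundary_values:
  assumes "2 \<le> N" "x \<in> {1..N}" and w: "w i 0 = \<rho>L i" "w i (N + 1) = \<rho>R i"
  shows "residual N \<epsilon> \<gamma> \<rho>L \<rho>R w i x =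
     \<epsilon> ^ i * (w i (x + 1) + w i (x - 1) - 2 * w i x) + \<gamma> * (w (1 - i) x - w i x)
     + (if x = 1 then (1 - \<epsilon> ^ i) * (\<rho>L i - w i 1) else 0)
     + (if x = N then (1 - \<epsilon> ^ i) * (\<rho>R i - w i N) else 0)"
proof -
  consider "x = 1" | "x = N" | "1 < x" "x < N" using assms(2) by fastforce
  then show ?thesis
    using assms(1) w
    by cases (auto simp: residual_def site_generator_def discrete_laplacian_def algebra_simps)
qed

section \<open>The limit profile in the discrete system\<close>

text \<open>The difference of the two limit densities; it solves g'' = B^2 g with the reservoir
  differences as boundary values.\<close>

definition layer_gap :: "real \<Rightarrow> (nat \<Rightarrow> real) \<Rightarrow> (nat \<Rightarrow> real) \<Rightarrow> real \<Rightarrow> real" where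
  "layer_gap B \<rho>L \<rho>R y =
     sinh (B * (1 - y)) / sinh B * (\<rho>L 0 - \<rho>L 1) + sinh (B * y) / sinh B * (\<rho>R 0 - \<rho>R 1)"

text \<open>The combination (\<rho>_0 + \<epsilon> \<rho>_1)/(1 + \<epsilon>), from which switching
  cancels at diffusive scale and which is therefore affine.\<close>

definition mean_profile :: "real \<Rightarrow> (nat \<Rightarrow> real) \<Rightarrow> (nat \<Rightarrow> real) \<Rightarrow> real \<Rightarrow> real" where
  "mean_profile \<epsilon> \<rho>L \<rho>R y = 1 / (1 + \<epsilon>) * (\<rho>R 0 * y + \<rho>L 0 * (1 - y))
     + \<epsilon> / (1 + \<epsilon>) * (\<rho>R 1 * y + \<rho>L 1 * (1 - y))"

lemma rho_stat_decomposition: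
  assumes "0 < \<epsilon>" "i \<in> {0,1}"
  shows "rho_stat \<epsilon> \<Upsilon> \<rho>L \<rho>R i y =
     (if i = 0 then \<epsilon> / (1 + \<epsilon>) else - 1 / (1 + \<epsilon>))
       * layer_gap (sqrt (\<Upsilon> * (1 + 1 / \<epsilon>))) \<rho>L \<rho>R y + mean_profile \<epsilon> \<rho>L \<rho>R y"
  using assms unfolding rho_stat_def Let_def layer_gap_def mean_profile_def
  by (auto simp: algebra_simps minus_divide_left[symmetric] diff_divide_distrib)

text \<open>Hyperbolic sines are exact eigenfunctions of the second difference, by the addition
  formula. No Taylor remainder that varies with the site has to be controlled.\<close>

lemma layer_gap_second_difference:
  "layer_gap B \<rho>L \<rho>R (y + t) + layer_gap B \<rho>L \<rho>R (y - t) - 2 * layer_gap B \<rho>L \<rho>R y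
     = 2 * (cosh (B * t) - 1) * layer_gap B \<rho>L \<rho>R y"
proof -
  have s: "sinh (a + b) + sinh (a - b) = 2 * cosh b * sinh a" for a b :: real
    by (simp add: sinh_add sinh_diff)
  have "sinh (B * (y + t)) + sinh (B * (y - t)) = 2 * cosh (B * t) * sinh (B * y)"
    using s[of "B * y" "B * t"] by (simp add: algebra_simps)
  moreover have "sinh (B * (1 - (y + t))) + sinh (B * (1 - (y - t))) = 2 * cosh (B * t) * sinh (B * (1 - y))"
    using s[of "B * (1 - y)" "B * t"] by (simp add: algebra_simps)
  moreover have "layer_gap B \<rho>L \<rho>R (y + t) + layer_gap B \<rho>L \<rho>R (y - t) =
      (sinh (B * (1 - (y + t))) + sinh (B * (1 - (y - t)))) / sinh B * (\<rho>L 0 - \<rho>L 1)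
      + (sinh (B * (y + t)) + sinh (B * (y - t))) / sinh B * (\<rho>R 0 - \<rho>R 1)"
    by (simp add: layer_gap_def add_divide_distrib algebra_simps)
  ultimately have "layer_gap B \<rho>L \<rho>R (y + t) + layer_gap B \<rho>L \<rho>R (y - t) =
      (2 * cosh (B * t) * sinh (B * (1 - y))) / sinh B * (\<rho>L 0 - \<rho>L 1)
      + (2 * cosh (B * t) * sinh (B * y)) / sinh B * (\<rho>R 0 - \<rho>R 1)" by simp
  then show ?thesis
    unfolding layer_gap_def by (simp add: algebra_simps add_divide_distrib diff_divide_distrib)
qed

lemma rate_constant_pos: "0 < \<epsilon> \<Longrightarrow> 0 < \<Upsilon> \<Longrightarrow> 0 < sqrt (\<Upsilon> * (1 + 1 / \<epsilon>))"
  by (intro real_sqrt_gt_zero mult_pos_pos add_pos_pos) auto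

lemma rho_stat_endpoints:
  assumes "0 < \<epsilon>" "0 < \<Upsilon>" "i \<in> {0,1}"
  shows "rho_stat \<epsilon> \<Upsilon> \<rho>L \<rho>R i 0 = \<rho>L i" "rho_stat \<epsilon> \<Upsilon> \<rho>L \<rho>R i 1 = \<rho>R i"
proof -
  have "sinh (sqrt (\<Upsilon> * (1 + 1 / \<epsilon>))) \<noteq> 0"
    using rate_constant_pos[OF assms(1,2)] by (metis less_irrefl sinh_real_zero_iff)
  then have g: "layer_gap (sqrt (\<Upsilon> * (1 + 1 / \<epsilon>))) \<rho>L \<rho>R 0 = \<rho>L 0 - \<rho>L 1"
    "layer_gap (sqrt (\<Upsilon> * (1 + 1 / \<epsilon>))) \<rho>L \<rho>R 1 = \<rho>R 0 - \<rho>R 1"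
    by (simp_all add: layer_gap_def)
  have k: "\<epsilon> / (1 + \<epsilon>) = 1 - 1 / (1 + \<epsilon>)" using assms(1) by (simp add: field_simps)
  show "rho_stat \<epsilon> \<Upsilon> \<rho>L \<rho>R i 0 = \<rho>L i" "rho_stat \<epsilon> \<Upsilon> \<rho>L \<rho>R i 1 = \<rho>R i"
    using assms(3) unfolding rho_stat_decomposition[OF assms(1,3)] g mean_profile_def k
    by (auto simp: algebra_simps diff_divide_distrib)
qed

lemma continuous_on_layer_gap: "0 < B \<Longrightarrow> continuous_on A (layer_gap B \<rho>L \<rho>R)"
  unfolding layer_gap_def by (intro continuous_intros) auto

lemma continuous_on_rho_stat:
  assumes "0 < \<epsilon>" "0 < \<Upsilon>" "i \<in> {0,1}"
  shows "continuous_on A (rho_stat \<epsilon> \<Upsilon> \<rho>L \<rho>R i)"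
  unfolding rho_stat_decomposition[OF assms(1,3), abs_def] mean_profile_def
  by (intro continuous_intros continuous_on_layer_gap rate_constant_pos assms)

text \<open>The affine mean has second difference 0 and the switching term sees only the gap. Both
  layers thus share one scalar defect up to sign, the discrete eigenvalue weighted by \<epsilon>/(1
  + \<epsilon>) minus \<gamma>.\<close>

lemma residual_rho_stat:
  fixes \<rho>L \<rho>R :: "nat \<Rightarrow> real"
  assumes eps: "0 < \<epsilon>" and Ups: "0 < \<Upsilon>" and N: "2 \<le> N" and i: "i \<in> {0,1}" and x: "x \<in> {1..N}"
  defines "B \<equiv> sqrt (\<Upsilon> * (1 + 1 / \<epsilon>))" and "U \<equiv> rho_stat \<epsilon> \<Upsilon> \<rho>L \<rho>R"
  shows "residual N \<epsilon> \<gamma> \<rho>L \<rho>R (\<lambda>i x. U i (real x / (real N + 1))) i x =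
     (if i = 0 then 1 else -1) * layer_gap B \<rho>L \<rho>R (real x / (real N + 1))
       * (\<epsilon> / (1 + \<epsilon>) * (2 * (cosh (B / (real N + 1)) - 1)) - \<gamma>)
     + (if x = 1 then (1 - \<epsilon> ^ i) * (\<rho>L i - U i (1 / (real N + 1))) else 0)
     + (if x = N then (1 - \<epsilon> ^ i) * (\<rho>R i - U i (real N / (real N + 1))) else 0)"
proof -
  define t y where "t = 1 / (real N + 1)" and "y = real x / (real N + 1)"
  let ?g = "layer_gap B \<rho>L \<rho>R" and ?c = "2 * (cosh (B / (real N + 1)) - 1)"
  have U0: "U 0 z = \<epsilon> / (1 + \<epsilon>) * ?g z + mean_profile \<epsilon> \<rho>L \<rho>R z"
    and U1: "U 1 z = - 1 / (1 + \<epsilon>) * ?g z + mean_profile \<epsilon> \<rho>L \<rho>R z" for z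
    unfolding U_def B_def by (simp_all add: rho_stat_decomposition[OF eps])
  have m: "mean_profile \<epsilon> \<rho>L \<rho>R (y + t) + mean_profile \<epsilon> \<rho>L \<rho>R (y - t) - 2 * mean_profile \<epsilon> \<rho>L \<rho>R y = 0"
    unfolding mean_profile_def by (simp add: algebra_simps)
  have g: "?g (y + t) + ?g (y - t) - 2 * ?g y = ?c * ?g y"
    using layer_gap_second_difference[of B \<rho>L \<rho>R y t] by (simp add: t_def)
  have "U 0 (y + t) + U 0 (y - t) - 2 * U 0 y =
      \<epsilon> / (1 + \<epsilon>) * (?g (y + t) + ?g (y - t) - 2 * ?g y)
      + (mean_profile \<epsilon> \<rho>L \<rho>R (y + t) + mean_profile \<epsilon> \<rho>L \<rho>R (y - t) - 2 * mean_profile \<epsilon> \<rho>L \<rho>R y)"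
    unfolding U0 by argo
  then have d0: "U 0 (y + t) + U 0 (y - t) - 2 * U 0 y = \<epsilon> / (1 + \<epsilon>) * (?c * ?g y)"
    unfolding g m by simp
  have "U 1 (y + t) + U 1 (y - t) - 2 * U 1 y =
      - 1 / (1 + \<epsilon>) * (?g (y + t) + ?g (y - t) - 2 * ?g y)
      + (mean_profile \<epsilon> \<rho>L \<rho>R (y + t) + mean_profile \<epsilon> \<rho>L \<rho>R (y - t) - 2 * mean_profile \<epsilon> \<rho>L \<rho>R y)"
    unfolding U1 by argo
  then have d1: "U 1 (y + t) + U 1 (y - t) - 2 * U 1 y = - 1 / (1 + \<epsilon>) * (?c * ?g y)"
    unfolding g m by simp
  have gap: "U 0 y - U 1 y = ?g y"
  proof -
    have "U 0 y - U 1 y = (\<epsilon> + 1) / (1 + \<epsilon>) * ?g y" unfolding U0 U1 by algebra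
    moreover have "(\<epsilon> + 1) / (1 + \<epsilon>) = 1" using eps by simp
    ultimately show ?thesis by (simp only: mult_1)
  qed
  have bulk: "\<epsilon> ^ i * (U i (y + t) + U i (y - t) - 2 * U i y) + \<gamma> * (U (1 - i) y - U i y) =
      (if i = 0 then 1 else -1) * ?g y * (\<epsilon> / (1 + \<epsilon>) * ?c - \<gamma>)"
  proof (cases "i = 0")
    case True
    then show ?thesis using d0 gap by (simp add: algebra_simps)
  next
    case False
    with i have "i = 1" by simp
    have "\<epsilon> * (U 1 (y + t) + U 1 (y - t) - 2 * U 1 y) + \<gamma> * (U 0 y - U 1 y)
        = \<epsilon> * (- 1 / (1 + \<epsilon>) * (?c * ?g y)) + \<gamma> * ?g y"
      unfolding d1 gap ..
    also have "\<dots> = - 1 * ?g y * (\<epsilon> / (1 + \<epsilon>) * ?c - \<gamma>)" by (simp add: algebra_simps)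
    finally show ?thesis using \<open>i = 1\<close> by simp
  qed
  have sh: "real (x + 1) / (real N + 1) = y + t" "real (x - 1) / (real N + 1) = y - t"
    using x by (auto simp: y_def t_def add_divide_distrib diff_divide_distrib of_nat_diff)
  have "U i (real 0 / (real N + 1)) = \<rho>L i" "U i (real (N + 1) / (real N + 1)) = \<rho>R i"
    using rho_stat_endpoints[OF eps Ups i, of \<rho>L \<rho>R] by (simp_all add: U_def add.commute)
  note r = residual_boundary_values[where i=i and N=N and x=x and \<rho>L=\<rho>L and \<rho>R=\<rho>R and w="\<lambda>i x. U i (real x / (real N + 1))", OF N x this]
  show ?thesis
    unfolding r sh y_def[symmetric] bulk by simp
qed

text \<open>The scalar defect is o(1/N^2) and the gap is bounded on the unit interval, which settles
  the bulk. At the ends continuity of the profile up to the reservoir values suffices.\<close>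

lemma eventually_residual_rho_stat_small:
  fixes \<rho>L \<rho>R \<gamma> :: "nat \<Rightarrow> real"
  assumes eps: "0 < \<epsilon>" "\<epsilon> \<le> 1" and Ups: "0 < \<Upsilon>"
    and lim: "(\<lambda>N. \<gamma> N * (real N)\<^sup>2) \<longlonglongrightarrow> \<Upsilon>" and del: "0 < \<delta>"
  shows "\<forall>\<^sub>F N in sequentially. \<forall>i\<in>{0,1}. \<forall>x\<in>{1..N}.
      \<bar>residual N \<epsilon> (\<gamma> N) \<rho>L \<rho>R (\<lambda>i x. rho_stat \<epsilon> \<Upsilon> \<rho>L \<rho>R i (real x / (real N + 1))) i x\<bar>
        < \<delta> * ((if x = 1 \<or> x = N then 1 else 0) + 1 / (real N)\<^sup>2)"
proof -
  define B where "B = sqrt (\<Upsilon> * (1 + 1 / \<epsilon>))"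
  define U where "U = rho_stat \<epsilon> \<Upsilon> \<rho>L \<rho>R"
  define q where "q N = \<epsilon> / (1 + \<epsilon>) * (2 * (cosh (B / (real N + 1)) - 1)) - \<gamma> N" for N
  let ?g = "layer_gap B \<rho>L \<rho>R"
  have B: "0 < B" unfolding B_def by (rule rate_constant_pos[OF eps(1) Ups])
  have "bounded (?g ` {0..1})"
    by (intro compact_imp_bounded compact_continuous_image continuous_on_layer_gap B compact_Icc)
  then obtain G where G: "0 < G" "\<And>y. y \<in> {0..1} \<Longrightarrow> \<bar>?g y\<bar> \<le> G"
    by (auto simp: bounded_pos)
  have "(\<lambda>N. (2 * (cosh (B / (real N + 1)) - 1)) * (real N)\<^sup>2) \<longlonglongrightarrow> B\<^sup>2"
    unfolding cosh_field_def by (real_asymp, simp add: power2_eq_square)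
  then have "(\<lambda>N. \<epsilon> / (1 + \<epsilon>) * ((2 * (cosh (B / (real N + 1)) - 1)) * (real N)\<^sup>2) - \<gamma> N * (real N)\<^sup>2)
      \<longlonglongrightarrow> \<epsilon> / (1 + \<epsilon>) * B\<^sup>2 - \<Upsilon>"
    by (intro tendsto_intros lim)
  \<comment> \<open>This identity is the origin of \<open>B\<close>: it balances the leading order
    of the discrete eigenvalue against the limit of \<gamma> N^2.\<close>
  moreover have "\<epsilon> / (1 + \<epsilon>) * B\<^sup>2 - \<Upsilon> = 0"
  proof -
    have "B\<^sup>2 = \<Upsilon> * (1 + 1 / \<epsilon>)" unfolding B_def using eps Ups by simp
    moreover have "1 + 1 / \<epsilon> = (1 + \<epsilon>) / \<epsilon>" using eps by (simp add: field_simps)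
    ultimately show ?thesis using eps by simp
  qed
  ultimately have "(\<lambda>N. q N * (real N)\<^sup>2) \<longlonglongrightarrow> 0"
    by (simp add: q_def left_diff_distrib mult.assoc)
  then have evq: "\<forall>\<^sub>F N in sequentially. \<bar>q N * (real N)\<^sup>2\<bar> < \<delta> / G"
    using G(1) del tendsto_rabs_zero by (intro order_tendstoD(2)[of _ 0]) auto
  have U: "(\<lambda>N. U i (f N)) \<longlonglongrightarrow> U i a" if "f \<longlonglongrightarrow> a" "i \<in> {0,1}" for f :: "nat \<Rightarrow> real" and a i
    using continuous_on_rho_stat[OF eps(1) Ups that(2), of UNIV \<rho>L \<rho>R] that(1)
    unfolding U_def[symmetric] by (rule continuous_on_tendsto_compose) auto
  have evL: "\<forall>\<^sub>F N in sequentially. \<bar>\<rho>L i - U i (1 / (real N + 1))\<bar> < \<delta>" if i: "i \<in> {0,1}" for i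
  proof -
    have "(\<lambda>N. 1 / (real N + 1)) \<longlonglongrightarrow> 0" by real_asymp
    from tendstoD[OF U[OF this i] del] show ?thesis
      using rho_stat_endpoints[OF eps(1) Ups i, of \<rho>L \<rho>R]
      by (simp add: U_def dist_real_def abs_minus_commute)
  qed
  have evR: "\<forall>\<^sub>F N in sequentially. \<bar>\<rho>R i - U i (real N / (real N + 1))\<bar> < \<delta>" if i: "i \<in> {0,1}" for i
  proof -
    have "(\<lambda>N. real N / (real N + 1)) \<longlonglongrightarrow> 1" by real_asymp
    from tendstoD[OF U[OF this i] del] show ?thesis
      using rho_stat_endpoints[OF eps(1) Ups i, of \<rho>L \<rho>R]
      by (simp add: U_def dist_real_def abs_minus_commute)
  qed
  from evL[of 0] evL[of 1] evR[of 0] evR[of 1]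
  have "\<forall>\<^sub>F N in sequentially. \<forall>i\<in>{0,1}. \<bar>\<rho>L i - U i (1 / (real N + 1))\<bar> < \<delta> \<and>
      \<bar>\<rho>R i - U i (real N / (real N + 1))\<bar> < \<delta>"
    by (simp add: eventually_conj_iff)
  with evq eventually_ge_at_top[of 2] show ?thesis
  proof eventually_elim
    case (elim N)
    show ?case
    proof (intro ballI)
      fix i x assume i: "i \<in> {0,1::nat}" and x: "x \<in> {1..N}"
      let ?y = "real x / (real N + 1)"
      let ?e = "if x = 1 then (1 - \<epsilon> ^ i) * (\<rho>L i - U i (1 / (real N + 1))) else 0"
      let ?f = "if x = N then (1 - \<epsilon> ^ i) * (\<rho>R i - U i (real N / (real N + 1))) else 0"
      have y: "?y \<in> {0..1}" using x by (auto simp: divide_le_eq_1)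
      have "\<bar>?g ?y * q N\<bar> \<le> G * \<bar>q N\<bar>"
        unfolding abs_mult by (intro mult_right_mono G y) auto
      also have "\<dots> < \<delta> / (real N)\<^sup>2"
        using elim(1,2) G(1) by (simp add: abs_mult field_simps)
      finally have bulk: "\<bar>?g ?y * q N\<bar> < \<delta> / (real N)\<^sup>2" .
      have p: "\<bar>(1 - \<epsilon> ^ i) * z\<bar> \<le> \<bar>z\<bar>" for z
      proof -
        have "\<bar>1 - \<epsilon> ^ i\<bar> \<le> 1" using i eps by auto
        then show ?thesis unfolding abs_mult by (rule mult_left_le_one_le[rotated 2]) auto
      qed
      have "\<bar>?e\<bar> + \<bar>?f\<bar> \<le> \<delta> * (if x = 1 \<or> x = N then 1 else 0)"
        using p[of "\<rho>L i - U i (1 / (real N + 1))"] p[of "\<rho>R i - U i (real N / (real N + 1))"]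
          elim(2) elim(3)[rule_format, OF i] by auto
      moreover have tri: "\<bar>a + b + c\<bar> \<le> \<bar>a\<bar> + (\<bar>b\<bar> + \<bar>c\<bar>)" for a b c :: real by linarith
      have "\<bar>(if i = 0 then 1 else -1) * ?g ?y * q N + ?e + ?f\<bar> \<le> \<bar>?g ?y * q N\<bar> + (\<bar>?e\<bar> + \<bar>?f\<bar>)"
        by (rule order_trans[OF tri]) (simp add: abs_mult)
      moreover have "residual N \<epsilon> (\<gamma> N) \<rho>L \<rho>R (\<lambda>i x. rho_stat \<epsilon> \<Upsilon> \<rho>L \<rho>R i (real x / (real N + 1))) i x
          = (if i = 0 then 1 else -1) * ?g ?y * q N + ?e + ?f"
        unfolding q_def U_def B_def by (rule residual_rho_stat[OF eps(1) Ups elim(2) i x])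
      ultimately show "\<bar>residual N \<epsilon> (\<gamma> N) \<rho>L \<rho>R
            (\<lambda>i x. rho_stat \<epsilon> \<Upsilon> \<rho>L \<rho>R i (real x / (real N + 1))) i x\<bar>
          < \<delta> * ((if x = 1 \<or> x = N then 1 else 0) + 1 / (real N)\<^sup>2)"
        using bulk unfolding distrib_left mult_1_right times_divide_eq_right by linarith
    qed
  qed
qed

text \<open>For zero diffusion in layer 1 that layer follows layer 0 in the bulk, but at its two end
  sites the reservoirs win over the switching, whose rate tends to 0.\<close>

definition frozen_profile :: "(nat \<Rightarrow> real) \<Rightarrow> (nat \<Rightarrow> real) \<Rightarrow> nat \<Rightarrow> nat \<Rightarrow> nat \<Rightarrow> real" where
  "frozen_profile \<rho>L \<rho>R N i x =
     (if i = 1 \<and> x = 1 then \<rho>L 1 else if i = 1 \<and> x = N then \<rho>R 1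
      else \<rho>L 0 + (\<rho>R 0 - \<rho>L 0) * (real x / (real N + 1)))"

text \<open>Hopping in layer 0 and the reservoirs are matched exactly, so only switching remains.
  The two layers agree away from the end sites, and at these sites the defect is at most a constant
  times \<gamma>, which tends to 0.\<close>

lemma eventually_residual_frozen_small:
  fixes \<rho>L \<rho>R \<gamma> :: "nat \<Rightarrow> real"
  assumes Ups: "0 < \<Upsilon>" and lim: "(\<lambda>N. \<gamma> N * (real N)\<^sup>2) \<longlonglongrightarrow> \<Upsilon>" and del: "0 < \<delta>"
  shows "\<forall>\<^sub>F N in sequentially. \<forall>i\<in>{0,1}. \<forall>x\<in>{1..N}.
      \<bar>residual N 0 (\<gamma> N) \<rho>L \<rho>R (frozen_profile \<rho>L \<rho>R N) i x\<bar>
        < \<delta> * ((if x = 1 \<or> x = N then 1 else 0) + 1 / (real N)\<^sup>2)"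
proof -
  let ?w = "frozen_profile \<rho>L \<rho>R"
  \<comment> \<open>Bounds the difference of the two layers at an end site; the summand 1 keeps it
    positive for the division.\<close>
  define M where "M = \<bar>\<rho>L 0\<bar> + \<bar>\<rho>R 0 - \<rho>L 0\<bar> + \<bar>\<rho>L 1\<bar> + \<bar>\<rho>R 1\<bar> + 1"
  have M: "0 < M" unfolding M_def by linarith
  have "(\<lambda>N. \<gamma> N * (real N)\<^sup>2 * (1 / (real N)\<^sup>2)) \<longlonglongrightarrow> \<Upsilon> * 0"
    by (rule tendsto_mult[OF lim]) real_asymp
  moreover have "\<forall>\<^sub>F N in sequentially. \<gamma> N * (real N)\<^sup>2 * (1 / (real N)\<^sup>2) = \<gamma> N"
    using eventually_gt_at_top[of 0] by eventually_elim simp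
  ultimately have "\<gamma> \<longlonglongrightarrow> \<Upsilon> * 0" by (rule Lim_transform_eventually)
  then have "\<gamma> \<longlonglongrightarrow> 0" by simp
  then have ev: "\<forall>\<^sub>F N in sequentially. \<bar>\<gamma> N\<bar> < \<delta> / M"
    using M del tendsto_rabs_zero by (intro order_tendstoD(2)[of _ 0]) auto
  from ev eventually_ge_at_top[of 2] show ?thesis
  proof eventually_elim
    case (elim N)
    show ?case
    proof (intro ballI)
      fix i x assume i: "i \<in> {0,1::nat}" and x: "x \<in> {1..N}"
      have lin: "\<bar>\<rho>L 0 + (\<rho>R 0 - \<rho>L 0) * (real x / (real N + 1))\<bar> \<le> \<bar>\<rho>L 0\<bar> + \<bar>\<rho>R 0 - \<rho>L 0\<bar>"
      proof -
        have "\<bar>(\<rho>R 0 - \<rho>L 0) * (real x / (real N + 1))\<bar> \<le> \<bar>\<rho>R 0 - \<rho>L 0\<bar> * 1"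
          unfolding abs_mult using x by (intro mult_left_mono) (auto simp: divide_le_eq_1)
        then show ?thesis by (intro order_trans[OF abs_triangle_ineq] add_left_mono) simp
      qed
      have res: "residual N 0 (\<gamma> N) \<rho>L \<rho>R (?w N) i x = \<gamma> N * (?w N (1 - i) x - ?w N i x)"
      proof (cases "i = 0")
        case True
        then show ?thesis
          using x elim(2)
          by (subst residual_boundary_values)
            (auto simp: frozen_profile_def add_divide_distrib diff_divide_distrib of_nat_diff algebra_simps)
      next
        case False
        with i have "i = 1" by simp
        then show ?thesis using elim(2)
          by (auto simp: residual_def site_generator_def frozen_profile_def)
      qed
      have "\<bar>?w N (1 - i) x - ?w N i x\<bar> \<le> (if x = 1 \<or> x = N then M else 0)"
        using i lin unfolding frozen_profile_def M_def by auto
      then have "\<bar>\<gamma> N\<bar> * \<bar>?w N (1 - i) x - ?w N i x\<bar> \<le> \<bar>\<gamma> N\<bar> * (if x = 1 \<or> x = N then M else 0)"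
        by (intro mult_left_mono) auto
      also have "\<dots> \<le> \<delta> * (if x = 1 \<or> x = N then 1 else 0)"
        using elim(1) M by (auto simp: field_simps)
      finally have "\<bar>residual N 0 (\<gamma> N) \<rho>L \<rho>R (?w N) i x\<bar> \<le> \<delta> * (if x = 1 \<or> x = N then 1 else 0)"
        unfolding res abs_mult .
      moreover have "0 < \<delta> * (1 / (real N)\<^sup>2)" using del elim(2) by simp
      ultimately show "\<bar>residual N 0 (\<gamma> N) \<rho>L \<rho>R (?w N) i x\<bar>
          < \<delta> * ((if x = 1 \<or> x = N then 1 else 0) + 1 / (real N)\<^sup>2)"
        unfolding distrib_left by linarith
    qed
  qed
qed

section \<open>From sites to macroscopic points\<close>

lemma site_near_point:
  assumes y: "y \<in> {0<..<1}" and N: "1 \<le> N"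
  defines "x \<equiv> nat \<lceil>y * real N\<rceil>"
  shows "x \<in> {1..N}" "\<bar>real x / (real N + 1) - y\<bar> \<le> 1 / (real N + 1)"
proof -
  have pos: "0 < y * real N" using y N by simp
  have le: "y * real N \<le> real N" using y by (simp add: mult_left_le_one_le)
  have "0 < \<lceil>y * real N\<rceil>" using pos by simp
  moreover have "\<lceil>y * real N\<rceil> \<le> int N" using le by (simp add: ceiling_le_iff)
  ultimately show "x \<in> {1..N}" unfolding x_def atLeastAtMost_iff by linarith
  have "real x = of_int \<lceil>y * real N\<rceil>" unfolding x_def using pos by simp
  then have "y * real N \<le> real x" "real x < y * real N + 1"
    using ceiling_correct[of "y * real N"] by linarith+
  \<comment> \<open>Rounding up gives an excess in [0, 1) over yN, and passing to N + 1 subtracts y,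
    which lies in (0, 1).\<close>
  then have "\<bar>real x - y * (real N + 1)\<bar> \<le> 1"
    using y unfolding abs_le_iff by (simp add: algebra_simps)
  moreover have "real x / (real N + 1) - y = (real x - y * (real N + 1)) / (real N + 1)"
    by (simp add: field_simps)
  ultimately show "\<bar>real x / (real N + 1) - y\<bar> \<le> 1 / (real N + 1)"
    by (simp add: abs_divide divide_right_mono)
qed

theorem mainTheorem8:
  fixes \<sigma> :: int and \<epsilon> \<Upsilon> :: real and \<rho>L \<rho>R :: "nat \<Rightarrow> real"
    and \<gamma> :: "nat \<Rightarrow> real" and \<mu> :: "nat \<Rightarrow> config pmf"
  assumes sigma: "\<sigma> \<in> {-1, 0, 1}"
    and eps: "0 \<le> \<epsilon>" "\<epsilon> \<le> 1"
    and rho_nonneg: "\<forall>i\<in>{0,1}. 0 \<le> \<rho>L i \<and> 0 \<le> \<rho>R i"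
    and rho_excl: "\<sigma> = -1 \<longrightarrow> (\<forall>i\<in>{0,1}. \<rho>L i \<le> 1 \<and> \<rho>R i \<le> 1)"
    and Ups: "\<Upsilon> > 0"
    and gamma_pos: "\<forall>N. \<gamma> N > 0"
    and gamma_lim: "(\<lambda>N. \<gamma> N * (real N)\<^sup>2) \<longlonglongrightarrow> \<Upsilon>"
    and stat: "\<forall>N\<ge>1. stationary \<sigma> N \<epsilon> (\<gamma> N) \<rho>L \<rho>R (\<mu> N)"
  shows "(\<forall>i\<in>{0,1}. \<forall>y\<in>{0<..<1}.
            (\<lambda>N. profile (\<mu> N) i (nat \<lceil>y * real N\<rceil>)) \<longlonglongrightarrow> rho_stat \<epsilon> \<Upsilon> \<rho>L \<rho>R i y)
       \<and> (\<epsilon> > 0 \<longrightarrow> (\<forall>i\<in>{0,1}.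
            uniform_limit {0<..<1} (\<lambda>N y. profile (\<mu> N) i (nat \<lceil>y * real N\<rceil>))
                          (rho_stat \<epsilon> \<Upsilon> \<rho>L \<rho>R i) sequentially))"
proof -
  have chain: "boundary_driven \<sigma> N \<epsilon> (\<gamma> N) \<rho>L \<rho>R (\<mu> N)" if "2 \<le> N" for N
    using that sigma eps rho_nonneg rho_excl gamma_pos stat by unfold_locales auto
  show ?thesis
  proof (cases "\<epsilon> = 0")
    case False
    with eps have e0: "0 < \<epsilon>" by simp
    have unif: "uniform_limit {0<..<1} (\<lambda>N y. profile (\<mu> N) i (nat \<lceil>y * real N\<rceil>))
        (rho_stat \<epsilon> \<Upsilon> \<rho>L \<rho>R i) sequentially" if i: "i \<in> {0,1}" for i
    proof (rule uniform_limitI)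
      fix e :: real assume e: "0 < e"
      \<comment> \<open>The error at the sites is already uniform. Uniform continuity on the closed
        interval makes the replacement of the sample point by y uniform as well.\<close>
      have "uniformly_continuous_on {0..1} (rho_stat \<epsilon> \<Upsilon> \<rho>L \<rho>R i)"
        by (intro compact_uniformly_continuous continuous_on_rho_stat e0 Ups i compact_Icc)
      then obtain d where d: "0 < d" "\<And>y z. y \<in> {0..1} \<Longrightarrow> z \<in> {0..1} \<Longrightarrow> dist z y < d \<Longrightarrow>
          dist (rho_stat \<epsilon> \<Upsilon> \<rho>L \<rho>R i z) (rho_stat \<epsilon> \<Upsilon> \<rho>L \<rho>R i y) < e / 2"
        using e unfolding uniformly_continuous_on_def by (metis half_gt_zero)
      have "(\<lambda>N. 1 / (real N + 1)) \<longlonglongrightarrow> 0" by real_asymp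
      then have evd: "\<forall>\<^sub>F N in sequentially. 1 / (real N + 1) < d"
        using d(1) by (rule order_tendstoD)
      have "\<forall>\<^sub>F N in sequentially. \<forall>i\<in>{0,1}. \<forall>x\<in>{1..N}.
          \<bar>profile (\<mu> N) i x - rho_stat \<epsilon> \<Upsilon> \<rho>L \<rho>R i (real x / (real N + 1))\<bar> < e / 2"
        using e by (intro eventually_profile_approximation[OF chain gamma_lim Ups]
            eventually_residual_rho_stat_small e0 eps Ups gamma_lim) auto
      with evd eventually_ge_at_top[of 1]
      show "\<forall>\<^sub>F N in sequentially. \<forall>y\<in>{0<..<1}.
          dist (profile (\<mu> N) i (nat \<lceil>y * real N\<rceil>)) (rho_stat \<epsilon> \<Upsilon> \<rho>L \<rho>R i y) < e"
      proof eventually_elim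
        case (elim N)
        have unit: "real z / (real N + 1) \<in> {0..1}" if "z \<in> {1..N}" for z
          using that by (auto simp: divide_le_eq_1)
        show ?case
        proof
          fix y :: real assume y: "y \<in> {0<..<1}"
          let ?x = "nat \<lceil>y * real N\<rceil>"
          note x = site_near_point[OF y elim(2)]
          have "\<bar>profile (\<mu> N) i ?x - rho_stat \<epsilon> \<Upsilon> \<rho>L \<rho>R i (real ?x / (real N + 1))\<bar> < e / 2"
            using elim(3) i x(1) by blast
          moreover have "dist (real ?x / (real N + 1)) y < d"
            using x(2) elim(1) unfolding dist_real_def by linarith
          then have "\<bar>rho_stat \<epsilon> \<Upsilon> \<rho>L \<rho>R i (real ?x / (real N + 1)) - rho_stat \<epsilon> \<Upsilon> \<rho>L \<rho>R i y\<bar> < e / 2"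
            using d(2)[OF _ unit[OF x(1)]] y unfolding dist_real_def by auto
          ultimately show "dist (profile (\<mu> N) i ?x) (rho_stat \<epsilon> \<Upsilon> \<rho>L \<rho>R i y) < e"
            unfolding dist_real_def by linarith
        qed
      qed
    qed
    have "(\<lambda>N. profile (\<mu> N) i (nat \<lceil>y * real N\<rceil>)) \<longlonglongrightarrow> rho_stat \<epsilon> \<Upsilon> \<rho>L \<rho>R i y"
      if "i \<in> {0,1}" "y \<in> {0<..<1}" for i y
      by (rule tendsto_uniform_limitI[OF unif[OF that(1)] that(2)])
    with unif show ?thesis by blast
  next
    case True
    have "(\<lambda>N. profile (\<mu> N) i (nat \<lceil>y * real N\<rceil>)) \<longlonglongrightarrow> \<rho>L 0 + (\<rho>R 0 - \<rho>L 0) * y"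
      if i: "i \<in> {0,1}" and y: "y \<in> {0<..<1}" for i y
    proof -
      let ?x = "\<lambda>N. nat \<lceil>y * real N\<rceil>"
      have "(\<lambda>N. profile (\<mu> N) i (?x N) - frozen_profile \<rho>L \<rho>R N i (?x N)) \<longlonglongrightarrow> 0"
      proof (rule tendstoI)
        fix e :: real assume e: "0 < e"
        have "\<forall>\<^sub>F N in sequentially. \<forall>i\<in>{0,1}. \<forall>x\<in>{1..N}.
            \<bar>profile (\<mu> N) i x - frozen_profile \<rho>L \<rho>R N i x\<bar> < e"
          by (rule eventually_profile_approximation[OF chain[unfolded True] gamma_lim Ups
                eventually_residual_frozen_small[OF Ups gamma_lim] e])
        with eventually_ge_at_top[of 1]
        show "\<forall>\<^sub>F N in sequentially.
            dist (profile (\<mu> N) i (?x N) - frozen_profile \<rho>L \<rho>R N i (?x N)) 0 < e"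
        proof eventually_elim
          case (elim N)
          then show ?case using i site_near_point(1)[OF y elim(1)] by (auto simp: dist_real_def)
        qed
      qed
      moreover have "(\<lambda>N. frozen_profile \<rho>L \<rho>R N i (?x N)) \<longlonglongrightarrow> \<rho>L 0 + (\<rho>R 0 - \<rho>L 0) * y"
      proof -
        have "(\<lambda>N. real (?x N) / (real N + 1) - y) \<longlonglongrightarrow> 0"
        proof (rule Lim_null_comparison)
          show "\<forall>\<^sub>F N in sequentially. norm (real (?x N) / (real N + 1) - y) \<le> 1 / (real N + 1)"
            using eventually_ge_at_top[of 1]
            by eventually_elim (use site_near_point(2)[OF y] in auto)
          show "(\<lambda>N. 1 / (real N + 1)) \<longlonglongrightarrow> 0" by real_asymp
        qed
        then have "(\<lambda>N. real (?x N) / (real N + 1)) \<longlonglongrightarrow> y" by (simp add: LIM_zero_iff)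
        then have "(\<lambda>N. \<rho>L 0 + (\<rho>R 0 - \<rho>L 0) * (real (?x N) / (real N + 1)))
            \<longlonglongrightarrow> \<rho>L 0 + (\<rho>R 0 - \<rho>L 0) * y" by (intro tendsto_intros)
        moreover have "\<forall>\<^sub>F N in sequentially.
            \<rho>L 0 + (\<rho>R 0 - \<rho>L 0) * (real (?x N) / (real N + 1)) = frozen_profile \<rho>L \<rho>R N i (?x N)"
        proof -
          have "filterlim (\<lambda>N. y * real N) at_top sequentially" "filterlim (\<lambda>N. (1 - y) * real N) at_top sequentially"
            using y by real_asymp+
          then have "\<forall>\<^sub>F N in sequentially. 1 < y * real N" "\<forall>\<^sub>F N in sequentially. 1 < (1 - y) * real N"
            by (auto simp: filterlim_at_top_dense)
          then show ?thesis
          proof eventually_elim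
            case (elim N)
            have "1 < \<lceil>y * real N\<rceil>" "\<lceil>y * real N\<rceil> < int N"
              using elim by (simp_all add: less_ceiling_iff ceiling_less_iff algebra_simps)
            then have "?x N \<noteq> 1" "?x N \<noteq> N" by linarith+
            then show ?case by (simp add: frozen_profile_def)
          qed
        qed
        ultimately show ?thesis by (rule Lim_transform_eventually)
      qed
      ultimately show ?thesis using tendsto_add by fastforce
    qed
    then show ?thesis using True by (simp add: rho_stat_def)
  qed
qed

end
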